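(* Let $e\in\mathbb{R}$, $\vec\mu\in\mathbb{R}^3$, $c>0$. For $a,\epsilon\in\,]0,1[$ let $$\vec E=e\big[\Upsilon_2(r)-\Upsilon'_1(r)\big]\vec u,\qquad \vec H=\big[3\vec u(\vec\mu\cdot\vec u)-\vec\mu\big]\Upsilon_3(r)-\big[\vec u(\vec\mu\cdot\vec u)-\vec\mu\big]\Upsilon'_2(r)$$ be the Colombeau-regularized electric and magnetic fields of a pole-dipole singularity at the origin, with $\Upsilon_n,\Upsilon'_n$ as in the context. Define the self-momentum and the self-angular-momentum (spin) by $$\vec P(a,\epsilon)=\frac{1}{4\pi c}\int_{\mathbb{R}^3}\vec E\times\vec H\,d^3r,\qquad \vec S(a,\epsilon)=\frac{1}{4\pi c}\int_{\mathbb{R}^3}\vec r\times(\vec E\times\vec H)\,d^3r .$$ Then: (i) $\vec P(a,\epsilon)=0$ for all $a,\epsilon\in\,]0,1[$; (ii) for every fixed $a\in\,]0,1[$, $$\lim_{\epsilon\to0^+}\left(\vec S(a,\epsilon)-\frac{2e}{3c}\,\vec\mu\,\frac{M}{\epsilon}\right)=0,\qquad M=\int_{-\infty}^{\infty}\eta(-z)^2\,dz ,$$ so that the diverging expression for the spin does not depend on $a$.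
   Context: Mollifier: $\eta\in\mathcal{S}(\mathbb{R})$ is a fixed real-valued even Schwartz function with $\int_{\mathbb{R}}\eta(z)\,dz=1$ and $\int_{\mathbb{R}}z^n\eta(z)\,dz=0$ for all integers $n\ge1$. A distribution $f$ on $\mathbb{R}$ is regularized as $f_\epsilon(x)=\int_{\mathbb{R}}\frac1\epsilon\,\eta\big(\frac{y-x}{\epsilon}\big)f(y)\,dy$ (with the usual distributional meaning). Regularized functions: $\vec r\in\mathbb{R}^3$, $r=|\vec r\,|\ge0$, $\vec u=\vec r/r$, $\mathrm{H}$ is the Heaviside function, $\delta$ the Dirac distribution. For $n\ge1$, $\Upsilon_n$ and $\Upsilon'_n$ (depending on $a,\epsilon$) denote the regularizations of the distributions $y\mapsto y^{-n}\mathrm{H}(y-a)$ and $y\mapsto y^{-n}\delta(y-a)$, that is, $$\Upsilon_n(r)=\int_{(a-r)/\epsilon}^{\infty}\frac{\eta(z)}{(r+\epsilon z)^n}\,dz,\qquad \Upsilon'_n(r)=\frac{1}{a^n\epsilon}\,\eta\Big(\frac{a-r}{\epsilon}\Big).$$ In the formal notation $\Upsilon_n=r^{-n}\Upsilon$, $\Upsilon'_n=r^{-n}\Upsilon'$, one has $\vec E=-\vec\nabla(e\,r^{-1}\Upsilon)$ and $\vec H=\vec\nabla\times\big(\frac{\vec\mu\times\vec r}{r^3}\Upsilon\big)$. The limit $\epsilon\to0$ is always taken before $a\to0$. *)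

theory Defs
  imports "HOL-Analysis.Analysis"
begin

definition schwartz :: "(real \<Rightarrow> real) \<Rightarrow> bool" where
  "schwartz f \<longleftrightarrow>
     (\<forall>k x. (deriv ^^ k) f field_differentiable at x) \<and>
     (\<forall>m k. bounded (range (\<lambda>x. x ^ m * (deriv ^^ k) f x)))"

definition mollifier :: "(real \<Rightarrow> real) \<Rightarrow> bool" where
  "mollifier \<eta> \<longleftrightarrow>
     schwartz \<eta> \<and>
     (\<forall>z. \<eta> (- z) = \<eta> z) \<and>
     (LBINT z. \<eta> z) = 1 \<and>
     (\<forall>n::nat. n \<ge> 1 \<longrightarrow> (LBINT z. z ^ n * \<eta> z) = 0)"

text \<open>
  The regularizations, evaluated at \<open>r\<close>, of the distributions \<open>y\<^sup>-\<^sup>n H(y - a)\<close> and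
  \<open>y\<^sup>-\<^sup>n \<delta>(y - a)\<close>. The first is written after the substitution \<open>y = r + \<epsilon> z\<close>; on the
  domain of integration \<open>r + \<epsilon> z \<ge> a > 0\<close>.
\<close>

definition Upsilon :: "(real \<Rightarrow> real) \<Rightarrow> real \<Rightarrow> real \<Rightarrow> nat \<Rightarrow> real \<Rightarrow> real" where
  "Upsilon \<eta> a \<epsilon> n r = (LBINT z:{(a - r) / \<epsilon>..}. \<eta> z / (r + \<epsilon> * z) ^ n)"

definition Upsilon' :: "(real \<Rightarrow> real) \<Rightarrow> real \<Rightarrow> real \<Rightarrow> nat \<Rightarrow> real \<Rightarrow> real" where
  "Upsilon' \<eta> a \<epsilon> n r = 1 / (a ^ n * \<epsilon>) * \<eta> ((a - r) / \<epsilon>)"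

text \<open>The value of \<open>unit_vec\<close> at the origin is \<open>0\<close>; this affects only a null set.\<close>

definition unit_vec :: "real ^ 3 \<Rightarrow> real ^ 3" where
  "unit_vec x = x /\<^sub>R norm x"

definition E_field ::
  "(real \<Rightarrow> real) \<Rightarrow> real \<Rightarrow> real \<Rightarrow> real \<Rightarrow> real ^ 3 \<Rightarrow> real ^ 3" where
  "E_field \<eta> e a \<epsilon> x =
     (e * (Upsilon \<eta> a \<epsilon> 2 (norm x) - Upsilon' \<eta> a \<epsilon> 1 (norm x))) *\<^sub>R unit_vec x"

definition H_field ::
  "(real \<Rightarrow> real) \<Rightarrow> real ^ 3 \<Rightarrow> real \<Rightarrow> real \<Rightarrow> real ^ 3 \<Rightarrow> real ^ 3" where
  "H_field \<eta> \<mu> a \<epsilon> x =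
     Upsilon \<eta> a \<epsilon> 3 (norm x) *\<^sub>R ((3 * (\<mu> \<bullet> unit_vec x)) *\<^sub>R unit_vec x - \<mu>)
     - Upsilon' \<eta> a \<epsilon> 2 (norm x) *\<^sub>R ((\<mu> \<bullet> unit_vec x) *\<^sub>R unit_vec x - \<mu>)"

definition momentum_density ::
  "(real \<Rightarrow> real) \<Rightarrow> real \<Rightarrow> real ^ 3 \<Rightarrow> real \<Rightarrow> real \<Rightarrow> real ^ 3 \<Rightarrow> real ^ 3" where
  "momentum_density \<eta> e \<mu> a \<epsilon> x = cross3 (E_field \<eta> e a \<epsilon> x) (H_field \<eta> \<mu> a \<epsilon> x)"

definition spin_density ::
  "(real \<Rightarrow> real) \<Rightarrow> real \<Rightarrow> real ^ 3 \<Rightarrow> real \<Rightarrow> real \<Rightarrow> real ^ 3 \<Rightarrow> real ^ 3" where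
  "spin_density \<eta> e \<mu> a \<epsilon> x = cross3 x (momentum_density \<eta> e \<mu> a \<epsilon> x)"

definition self_momentum ::
  "(real \<Rightarrow> real) \<Rightarrow> real \<Rightarrow> real \<Rightarrow> real ^ 3 \<Rightarrow> real \<Rightarrow> real \<Rightarrow> real ^ 3" where
  "self_momentum \<eta> c e \<mu> a \<epsilon> =
     (1 / (4 * pi * c)) *\<^sub>R (LBINT x. momentum_density \<eta> e \<mu> a \<epsilon> x)"

definition self_spin ::
  "(real \<Rightarrow> real) \<Rightarrow> real \<Rightarrow> real \<Rightarrow> real ^ 3 \<Rightarrow> real \<Rightarrow> real \<Rightarrow> real ^ 3" where
  "self_spin \<eta> c e \<mu> a \<epsilon> =
     (1 / (4 * pi * c)) *\<^sub>R (LBINT x. spin_density \<eta> e \<mu> a \<epsilon> x)"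

end

theory Submission
  imports Defs "HOL-Probability.Sinc_Integral" "HOL-Real_Asymp.Real_Asymp"
begin

text \<open>
  The momentum density is \<open>e G(r) u \<times> \<mu>\<close> with \<open>G = (\<Upsilon>\<^sub>2 - \<Upsilon>'\<^sub>1)(\<Upsilon>'\<^sub>2 - \<Upsilon>\<^sub>3)\<close>, an odd function, so its
  integral vanishes. The spin density is \<open>e r G(r) (u (\<mu> \<bullet> u) - \<mu>)\<close>; averaging \<open>u\<^sub>i u\<^sub>j\<close> over the
  sphere gives \<open>\<delta>\<^sub>i\<^sub>j / 3\<close>, which leaves \<open>- (8 \<pi> e / 3) \<mu>\<close> times the integral of \<open>r\<^sup>3 G\<close> over
  \<open>r > 0\<close>. Of the four products in \<open>G\<close>, the product of the two delta terms contributes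
  \<open>- M / \<epsilon> + o(1)\<close>, where the term of order one vanishes because \<open>w \<eta>(w)\<^sup>2\<close> is odd. Each mixed term
  tends to \<open>1 / (2 a)\<close>: near \<open>r = a\<close> the mollified step is the primitive of the mollified delta, which
  gives the factor \<open>1 / 2\<close>. The term \<open>- \<Upsilon>\<^sub>2 \<Upsilon>\<^sub>3\<close> tends to minus the integral of \<open>r\<^sup>-\<^sup>2\<close> over
  \<open>r > a\<close>, that is to \<open>- 1 / a\<close>, so that the finite parts cancel.
\<close>

section \<open>Integrals of radial functions on three-space\<close>

text \<open>Integration in polar coordinates, obtained from ball volumes: the volume
  \<open>4 / 3 * pi * a ^ 3\<close> is the integral of the sphere areas up to \<open>a\<close>, and
  the half-lines \<open>{..a}\<close> form an intersection-stable generator of the Borel sets on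
  which both measures are finite.\<close>

lemma distr_norm_lborel_3:
  "distr lborel borel (norm :: real^3 \<Rightarrow> real) =
     density lborel (\<lambda>r. ennreal (indicator {0<..} r * (4 * pi * r\<^sup>2)))"
  (is "?M = ?N")
proof (rule measure_eqI_generator_eq)
  let ?E = "range (\<lambda>a::real. {..a})"
  have M: "emeasure ?M {..a} = ennreal (if 0 \<le> a then 4 / 3 * pi * a ^ 3 else 0)" for a
  proof -
    have "norm -` {..a} = cball (0 :: real^3) a"
      by auto
    then have "emeasure ?M {..a} = emeasure lborel (cball (0 :: real^3) a)"
      by (subst emeasure_distr) auto
    also have "\<dots> = ennreal (if 0 \<le> a then 4 / 3 * pi * a ^ 3 else 0)"
      by (simp add: emeasure_cball unit_ball_vol_3)
    finally show ?thesis .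
  qed
  show "emeasure ?M X = emeasure ?N X" if "X \<in> ?E" for X
  proof -
    from that obtain a where X: "X = {..a}" by auto
    have "emeasure ?N {..a} =
        (\<integral>\<^sup>+ r. ennreal (indicator {0<..} r * (4 * pi * r\<^sup>2)) * indicator {..a} r \<partial>lborel)"
      by (subst emeasure_density) auto
    also have "\<dots> = ennreal (if 0 \<le> a then 4 / 3 * pi * a ^ 3 else 0)"
    proof (cases "0 \<le> a")
      case True
      have "(\<integral>\<^sup>+ r. ennreal (indicator {0<..} r * (4 * pi * r\<^sup>2)) * indicator {..a} r \<partial>lborel) =
          (\<integral>\<^sup>+ r. ennreal (4 * pi * r\<^sup>2) * indicator {0..a} r \<partial>lborel)"
        by (intro nn_integral_cong) (auto split: split_indicator)
      also have "\<dots> = ennreal (4 / 3 * pi * a ^ 3 - 4 / 3 * pi * 0 ^ 3)"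
        using True by (intro nn_integral_FTC_Icc) (auto intro!: derivative_eq_intros)
      finally show ?thesis using True by simp
    next
      case False
      have "(\<integral>\<^sup>+ r. ennreal (indicator {0<..} r * (4 * pi * r\<^sup>2)) * indicator {..a} r \<partial>lborel) =
          (\<integral>\<^sup>+ r. 0 \<partial>(lborel :: real measure))"
        using False by (intro nn_integral_cong) (auto split: split_indicator)
      then show ?thesis using False by simp
    qed
    finally show ?thesis by (simp add: X M)
  qed
  show "Int_stable ?E" by (auto simp: Int_stable_def)
  show "sets ?M = sigma_sets UNIV ?E" "sets ?N = sigma_sets UNIV ?E"
    by (simp_all add: borel_eq_atMost)
  show "range (\<lambda>i::nat. {..real i}) \<subseteq> ?E" by auto
  show "(\<Union>i::nat. {..real i}) = UNIV"
    by (auto simp: real_arch_simple)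
  show "emeasure ?M {..real i} \<noteq> \<infinity>" for i
    by (simp add: M)
qed auto

lemma
  fixes F :: "real \<Rightarrow> real"
  assumes [measurable]: "F \<in> borel_measurable borel"
  shows integrable_norm_3_iff: "integrable lborel (\<lambda>x::real^3. F (norm x)) \<longleftrightarrow>
      integrable lborel (\<lambda>r. indicator {0<..} r * (4 * pi * r\<^sup>2) * F r)"
    and integral_norm_3: "(LBINT x::real^3. F (norm x)) =
      (LBINT r. indicator {0<..} r * (4 * pi * r\<^sup>2) * F r)"
proof -
  show "integrable lborel (\<lambda>x::real^3. F (norm x)) \<longleftrightarrow>
      integrable lborel (\<lambda>r. indicator {0<..} r * (4 * pi * r\<^sup>2) * F r)"
    by (subst integrable_distr_eq[where N = borel, symmetric], measurable,
        subst distr_norm_lborel_3, subst integrable_density) auto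
  show "(LBINT x::real^3. F (norm x)) =
      (LBINT r. indicator {0<..} r * (4 * pi * r\<^sup>2) * F r)"
    by (subst integral_distr[where N = borel, symmetric], measurable,
        subst distr_norm_lborel_3, subst integral_density) auto
qed

text \<open>Lebesgue measure is determined by its values on boxes. The preimage of a box is its
  image under the inverse map, which is again orthogonal and hence preserves volume.\<close>

lemma distr_lborel_orthogonal:
  fixes T :: "real^'n::{finite,wellorder} \<Rightarrow> real^'n::_"
  assumes T: "orthogonal_transformation T"
  shows "distr lborel borel T = lborel"
proof (rule lborel_eqI[symmetric])
  have [measurable]: "T \<in> borel_measurable borel"
    using T by (intro borel_measurable_continuous_onI linear_continuous_on)
      (simp add: orthogonal_transformation_linear linear_linear)
  show "sets (distr lborel borel T) = sets borel" by simp
  fix l u :: "real^'n::_"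
  assume le: "\<And>b. b \<in> Basis \<Longrightarrow> l \<bullet> b \<le> u \<bullet> b"
  have inv: "orthogonal_transformation (inv T)"
    using T by (rule orthogonal_transformation_inv)
  have eq: "T -` box l u = inv T ` box l u"
    using T by (simp add: bij_vimage_eq_inv_image orthogonal_transformation_bij)
  have meas: "inv T ` box l u \<in> lmeasurable"
    using inv by (rule measurable_orthogonal_image) simp
  have "emeasure (distr lborel borel T) (box l u) = emeasure lborel (T -` box l u)"
    by (subst emeasure_distr) auto
  \<comment> \<open>Volume preservation is applied to the completed measure, which agrees with
    \<open>lborel\<close> on Borel sets.\<close>
  also have "\<dots> = emeasure lebesgue (T -` box l u)"
  proof -
    have "T -` box l u \<in> sets lborel"
      using measurable_sets_borel[of T borel "box l u"] by simp
    then show ?thesis by simp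
  qed
  also have "\<dots> = measure lebesgue (inv T ` box l u)"
    unfolding eq using meas by (rule emeasure_eq_measure2)
  also have "\<dots> = measure lebesgue (box l u)"
    using inv by (subst measure_orthogonal_image) auto
  also have "\<dots> = (\<Prod>b\<in>Basis. (u - l) \<bullet> b)"
    using le by simp
  finally show "emeasure (distr lborel borel T) (box l u) = (\<Prod>b\<in>Basis. (u - l) \<bullet> b)" .
qed

section \<open>Averages over the directions of \<open>unit_vec x\<close>\<close>

lemma measurable_unit_vec [measurable]: "unit_vec \<in> borel_measurable borel"
  unfolding unit_vec_def by measurable

lemma norm_unit_vec: "norm (unit_vec x) = (if x = 0 then 0 else 1)"
  by (simp add: unit_vec_def)

lemma abs_unit_vec_inner_le: "\<bar>unit_vec x \<bullet> v\<bar> \<le> norm v"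
  using Cauchy_Schwarz_ineq2[of "unit_vec x" v] by (auto simp: norm_unit_vec split: if_splits)

lemma unit_vec_orthogonal:
  assumes "orthogonal_transformation T"
  shows "unit_vec (T x) = T (unit_vec x)"
  using assms
  by (simp add: unit_vec_def orthogonal_transformation_norm orthogonal_transformation_scaleR)

lemma integrable_radial_scaleR:
  fixes F :: "real \<Rightarrow> real" and g :: "real^3 \<Rightarrow> 'b::{banach, second_countable_topology}"
  assumes F: "integrable lborel (\<lambda>x::real^3. F (norm x))"
    and [measurable]: "g \<in> borel_measurable borel"
    and le: "\<And>x. norm (g x) \<le> B"
  shows "integrable lborel (\<lambda>x. F (norm x) *\<^sub>R g x)"
proof (rule Bochner_Integration.integrable_bound)
  have [measurable]: "(\<lambda>x::real^3. F (norm x)) \<in> borel_measurable borel"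
    using borel_measurable_integrable[OF F] by simp
  show "(\<lambda>x. F (norm x) *\<^sub>R g x) \<in> borel_measurable lborel"
    by measurable
  show "integrable lborel (\<lambda>x::real^3. F (norm x) * B)"
    using F by simp
  show "AE x in lborel. norm (F (norm x) *\<^sub>R g x) \<le> norm (F (norm x) * B)"
  proof (rule AE_I2)
    fix x show "norm (F (norm x) *\<^sub>R g x) \<le> norm (F (norm x) * B)"
      using le[of x] norm_ge_zero[of "g x"] by (simp add: abs_mult mult_left_mono)
  qed
qed

text \<open>The diagonal case \<open>v = w\<close> is settled first; polarization then gives the
  mixed moments. The hypothesis \<open>F 0 = 0\<close> matches the convention
  \<open>unit_vec 0 = 0\<close>.\<close>

lemma radial_second_moment:
  fixes F :: "real \<Rightarrow> real" and v w :: "real^3"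
  assumes F: "integrable lborel (\<lambda>x::real^3. F (norm x))" and F0: "F 0 = 0"
  shows integrable_radial_second_moment:
      "integrable lborel (\<lambda>x. F (norm x) * ((unit_vec x \<bullet> v) * (unit_vec x \<bullet> w)))"
    and integral_radial_second_moment:
      "(LBINT x. F (norm x) * ((unit_vec x \<bullet> v) * (unit_vec x \<bullet> w))) =
        (v \<bullet> w) / 3 * (LBINT x::real^3. F (norm x))"
proof -
  have int: "integrable lborel (\<lambda>x. F (norm x) * ((unit_vec x \<bullet> v) * (unit_vec x \<bullet> w)))" for v w
  proof -
    have "integrable lborel (\<lambda>x. F (norm x) *\<^sub>R ((unit_vec x \<bullet> v) * (unit_vec x \<bullet> w)))"
      using F by (rule integrable_radial_scaleR[where B = "norm v * norm w"])
        (auto simp: abs_mult intro!: mult_mono abs_unit_vec_inner_le)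
    then show ?thesis by simp
  qed
  then show "integrable lborel (\<lambda>x. F (norm x) * ((unit_vec x \<bullet> v) * (unit_vec x \<bullet> w)))" .
  \<comment> \<open>Orthogonal invariance makes \<open>Q\<close> a multiple of the squared norm; the trace fixes the multiple.\<close>
  define Q where "Q v = (LBINT x. F (norm x) * (unit_vec x \<bullet> v)\<^sup>2)" for v
  have int2: "integrable lborel (\<lambda>x. F (norm x) * (unit_vec x \<bullet> v)\<^sup>2)" for v
    using int[of v v] by (simp add: power2_eq_square)
  have [measurable]: "(\<lambda>x::real^3. F (norm x)) \<in> borel_measurable borel"
    using borel_measurable_integrable[OF F] by simp
  have Q_orth: "Q (T v) = Q v" if T: "orthogonal_transformation T" for T v
  proof -
    have [measurable]: "T \<in> borel_measurable borel"
      using T by (intro borel_measurable_continuous_onI linear_continuous_on)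
        (simp add: orthogonal_transformation_linear linear_linear)
    have "Q (T v) = integral\<^sup>L (distr lborel borel T) (\<lambda>x. F (norm x) * (unit_vec x \<bullet> T v)\<^sup>2)"
      by (simp add: Q_def distr_lborel_orthogonal[OF T])
    also have "\<dots> = (LBINT x. F (norm (T x)) * (unit_vec (T x) \<bullet> T v)\<^sup>2)"
      by (rule integral_distr) auto
    also have "\<dots> = Q v"
      using T by (simp add: Q_def unit_vec_orthogonal orthogonal_transformation_def
          orthogonal_transformation_norm[OF T])
    finally show ?thesis .
  qed
  have Q_scale: "Q (c *\<^sub>R v) = c\<^sup>2 * Q v" for c v
    unfolding Q_def by (subst integral_mult_right_zero[symmetric])
      (simp add: power_mult_distrib mult.left_commute)
  have Q: "Q v = (norm v)\<^sup>2 * Q (axis 1 1)" for v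
  proof (cases "v = 0")
    case False
    have "norm (v /\<^sub>R norm v) = 1" using False by simp
    from orthogonal_transformation_exists_1[OF norm_axis_1 this]
    obtain T :: "real^3 \<Rightarrow> real^3"
      where T: "orthogonal_transformation T" "T (axis 1 1) = v /\<^sub>R norm v"
      by blast
    have "Q v = Q (norm v *\<^sub>R (v /\<^sub>R norm v))" using False by simp
    also have "\<dots> = (norm v)\<^sup>2 * Q (v /\<^sub>R norm v)"
      by (rule Q_scale)
    also have "Q (v /\<^sub>R norm v) = Q (axis 1 1)"
      using Q_orth[OF T(1), of "axis 1 1"] T(2) by simp
    finally show ?thesis .
  qed (simp add: Q_def)
  have "Q (axis 1 1) + Q (axis 2 1) + Q (axis 3 1) =
      (LBINT x. F (norm x) * (unit_vec x \<bullet> axis 1 1)\<^sup>2 + F (norm x) * (unit_vec x \<bullet> axis 2 1)\<^sup>2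
         + F (norm x) * (unit_vec x \<bullet> axis 3 1)\<^sup>2)"
    unfolding Q_def by (simp add: int2)
  also have "\<dots> = (LBINT x::real^3. F (norm x))"
  proof (rule Bochner_Integration.integral_cong)
    fix x :: "real^3"
    have "(unit_vec x $ 1)\<^sup>2 + (unit_vec x $ 2)\<^sup>2 + (unit_vec x $ 3)\<^sup>2 = (norm (unit_vec x))\<^sup>2"
      unfolding power2_norm_eq_inner by (simp add: inner_vec_def sum_3 power2_eq_square)
    \<comment> \<open>At the origin the three squares add up to 0 instead of 1, and
      \<open>F 0 = 0\<close> keeps the identity true there.\<close>
    then show "F (norm x) * (unit_vec x \<bullet> axis 1 1)\<^sup>2 + F (norm x) * (unit_vec x \<bullet> axis 2 1)\<^sup>2
         + F (norm x) * (unit_vec x \<bullet> axis 3 1)\<^sup>2 = F (norm x)"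
      using F0 by (simp add: inner_axis distrib_left[symmetric] norm_unit_vec)
  qed simp
  finally have q: "Q (axis 1 1) = (LBINT x::real^3. F (norm x)) / 3"
    using Q[of "axis 2 1"] Q[of "axis 3 1"] by simp
  \<comment> \<open>Polarization: a product is a quarter of the difference of the squares of sum and
    difference.\<close>
  have "(LBINT x. F (norm x) * ((unit_vec x \<bullet> v) * (unit_vec x \<bullet> w))) =
      (LBINT x. (F (norm x) * (unit_vec x \<bullet> (v + w))\<^sup>2 - F (norm x) * (unit_vec x \<bullet> (v - w))\<^sup>2) / 4)"
    by (intro Bochner_Integration.integral_cong)
      (auto simp: power2_eq_square algebra_simps)
  also have "\<dots> = (Q (v + w) - Q (v - w)) / 4"
    by (simp add: Q_def int2)
  also have "\<dots> = (v \<bullet> w) / 3 * (LBINT x::real^3. F (norm x))"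
    unfolding Q[of "v + w"] Q[of "v - w"] q
    by (simp add: power2_norm_eq_inner inner_diff_left inner_diff_right inner_add_left inner_add_right
        inner_commute field_simps)
  finally show "(LBINT x. F (norm x) * ((unit_vec x \<bullet> v) * (unit_vec x \<bullet> w))) =
        (v \<bullet> w) / 3 * (LBINT x::real^3. F (norm x))" .
qed

text \<open>Tested against an arbitrary vector \<open>w\<close>, the first term is a second moment
  and contributes 1/3, the second contributes -1; this is the origin of the factor -2/3.\<close>

lemma radial_spin_integral:
  fixes F :: "real \<Rightarrow> real" and \<mu> :: "real^3"
  assumes F: "integrable lborel (\<lambda>x::real^3. F (norm x))" and F0: "F 0 = 0"
  shows "integrable lborel (\<lambda>x. F (norm x) *\<^sub>R ((\<mu> \<bullet> unit_vec x) *\<^sub>R unit_vec x - \<mu>))" (is ?int)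
    and "(LBINT x. F (norm x) *\<^sub>R ((\<mu> \<bullet> unit_vec x) *\<^sub>R unit_vec x - \<mu>)) =
      - (2 / 3 * (LBINT x::real^3. F (norm x))) *\<^sub>R \<mu>"
proof -
  have le: "norm ((\<mu> \<bullet> unit_vec x) *\<^sub>R unit_vec x - \<mu>) \<le> norm \<mu> + norm \<mu>" for x
  proof -
    have "norm ((\<mu> \<bullet> unit_vec x) *\<^sub>R unit_vec x) \<le> norm \<mu>"
      using abs_unit_vec_inner_le[of x \<mu>] by (simp add: norm_unit_vec inner_commute)
    then show ?thesis
      using norm_triangle_ineq4[of "(\<mu> \<bullet> unit_vec x) *\<^sub>R unit_vec x" \<mu>] by linarith
  qed
  show int: ?int
    by (rule integrable_radial_scaleR[OF F _ le]) measurable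
  have "(LBINT x. F (norm x) *\<^sub>R ((\<mu> \<bullet> unit_vec x) *\<^sub>R unit_vec x - \<mu>)) \<bullet> w =
      (- (2 / 3 * (LBINT x::real^3. F (norm x))) *\<^sub>R \<mu>) \<bullet> w" for w
  proof -
    have "(LBINT x. F (norm x) *\<^sub>R ((\<mu> \<bullet> unit_vec x) *\<^sub>R unit_vec x - \<mu>)) \<bullet> w =
      (LBINT x. (F (norm x) *\<^sub>R ((\<mu> \<bullet> unit_vec x) *\<^sub>R unit_vec x - \<mu>)) \<bullet> w)"
      by (rule integral_inner_left[symmetric]) (rule int)
    also have "\<dots> = (LBINT x. F (norm x) * ((unit_vec x \<bullet> \<mu>) * (unit_vec x \<bullet> w)) - F (norm x) * (\<mu> \<bullet> w))"
      by (intro Bochner_Integration.integral_cong)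
        (auto simp: inner_diff_left inner_commute algebra_simps)
    also have "\<dots> = (\<mu> \<bullet> w) / 3 * (LBINT x::real^3. F (norm x)) - (LBINT x::real^3. F (norm x)) * (\<mu> \<bullet> w)"
      using F F0 by (simp add: integrable_radial_second_moment integral_radial_second_moment)
    finally show ?thesis by (simp add: field_simps)
  qed
  then show "(LBINT x. F (norm x) *\<^sub>R ((\<mu> \<bullet> unit_vec x) *\<^sub>R unit_vec x - \<mu>)) =
      - (2 / 3 * (LBINT x::real^3. F (norm x))) *\<^sub>R \<mu>"
    using vector_eq_rdot by blast
qed

text \<open>Reflection at the origin is orthogonal, so it preserves the measure and the integral
  equals its own negative.\<close>

lemma integral_odd_eq_0:
  fixes f :: "real^'n::{finite,wellorder} \<Rightarrow> 'b::{banach, second_countable_topology}"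
  assumes [measurable]: "f \<in> borel_measurable borel" and odd: "\<And>x. f (- x) = - f x"
  shows "(LBINT x. f x) = 0"
proof -
  have "distr lborel borel uminus = (lborel :: (real^'n::_) measure)"
    using distr_lborel_orthogonal[of "uminus"] by (simp add: orthogonal_transformation_neg)
  then have "(LBINT x. f x) = integral\<^sup>L (distr lborel borel uminus) f" by simp
  also have "\<dots> = (LBINT x. f (- x))"
    by (rule integral_distr) auto
  finally have "(LBINT x. f x) = - (LBINT x. f x)" by (simp add: odd)
  then have "2 *\<^sub>R (LBINT x. f x) = 0" by (simp add: scaleR_2 eq_neg_iff_add_eq_0)
  then show ?thesis by simp
qed

section \<open>Cross products and the pointwise form of the two densities\<close>

lemma norm_cross_le: "norm (cross3 x y) \<le> norm x * norm y"
proof (rule power2_le_imp_le)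
  show "(norm (cross3 x y))\<^sup>2 \<le> (norm x * norm y)\<^sup>2"
    unfolding norm_cross_dot[of x y, symmetric] by simp
qed simp

text \<open>The electric field is radial, so its cross product annihilates every part of the
  magnetic field along \<open>unit_vec x\<close>. Only the coefficient of \<open>\<mu>\<close>
  survives.\<close>

lemma momentum_density_eq:
  "momentum_density \<eta> e \<mu> a \<epsilon> x =
    (e * ((Upsilon \<eta> a \<epsilon> 2 (norm x) - Upsilon' \<eta> a \<epsilon> 1 (norm x)) *
      (Upsilon' \<eta> a \<epsilon> 2 (norm x) - Upsilon \<eta> a \<epsilon> 3 (norm x)))) *\<^sub>R cross3 (unit_vec x) \<mu>"
proof -
  \<comment> \<open>\<open>A\<close> is the radial factor of the electric field; \<open>B\<close>
    and \<open>C\<close> are the \<open>Upsilon\<close> and \<open>Upsilon'\<close> factors of the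
    magnetic field.\<close>
  have "cross3 (A *\<^sub>R u) (B *\<^sub>R ((3 * m) *\<^sub>R u - \<mu>) - C *\<^sub>R (m *\<^sub>R u - \<mu>)) =
      (A * (C - B)) *\<^sub>R cross3 u \<mu>" for A B C m and u :: "real^3"
  proof -
    have "B *\<^sub>R ((3 * m) *\<^sub>R u - \<mu>) - C *\<^sub>R (m *\<^sub>R u - \<mu>) =
        (C - B) *\<^sub>R \<mu> + (3 * m * B - m * C) *\<^sub>R u"
      by (simp add: vec_eq_iff algebra_simps)
    then show ?thesis
      by (simp add: cross_mult_left cross_mult_right cross_add_right)
  qed
  then show ?thesis
    by (simp add: momentum_density_def E_field_def H_field_def mult.assoc)
qed

text \<open>Away from the origin \<open>x\<close> is \<open>norm x\<close> times a unit vector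
  \<open>u\<close>, and the double cross product of \<open>u\<close>, \<open>u\<close>,
  \<open>\<mu>\<close> expands to \<open>(\<mu> \<bullet> u) *\<^sub>R u - \<mu>\<close>. At the
  origin the factor \<open>norm x\<close> makes both sides vanish.\<close>

lemma spin_density_eq:
  "spin_density \<eta> e \<mu> a \<epsilon> x =
    (e * norm x * ((Upsilon \<eta> a \<epsilon> 2 (norm x) - Upsilon' \<eta> a \<epsilon> 1 (norm x)) *
      (Upsilon' \<eta> a \<epsilon> 2 (norm x) - Upsilon \<eta> a \<epsilon> 3 (norm x)))) *\<^sub>R
      ((\<mu> \<bullet> unit_vec x) *\<^sub>R unit_vec x - \<mu>)"
proof (cases "x = 0")
  case True
  then show ?thesis by (simp add: spin_density_def)
next
  case False
  have x: "x = norm x *\<^sub>R unit_vec x"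
    using False by (simp add: unit_vec_def)
  have u: "unit_vec x \<bullet> unit_vec x = 1"
    using False by (simp add: norm_unit_vec dot_square_norm)
  have "cross3 x (cross3 (unit_vec x) \<mu>) =
      norm x *\<^sub>R cross3 (unit_vec x) (cross3 (unit_vec x) \<mu>)"
    using cross_mult_left[of "norm x" "unit_vec x"] x by metis
  also have "\<dots> = norm x *\<^sub>R ((\<mu> \<bullet> unit_vec x) *\<^sub>R unit_vec x - \<mu>)"
    by (simp add: Lagrange u inner_commute)
  finally show ?thesis
    by (simp add: spin_density_def momentum_density_eq cross_mult_right)
qed

section \<open>Convergence and decay on the real line\<close>

text \<open>The substitution of \<open>inverse t\<close> for \<open>t\<close> reduces the limit to
  one at infinity. The majorant is asked for only on \<open>0 < t < 1\<close>, the range of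
  \<open>\<epsilon>\<close> on which the later estimates are uniform.\<close>

lemma dominated_convergence_at_right_0:
  fixes s :: "real \<Rightarrow> 'a \<Rightarrow> 'b::{banach, second_countable_topology}"
  assumes "f \<in> borel_measurable M" "\<And>t. s t \<in> borel_measurable M" "integrable M w"
    and lim: "AE x in M. ((\<lambda>t. s t x) \<longlongrightarrow> f x) (at_right 0)"
    and bound: "\<And>t x. 0 < t \<Longrightarrow> t < 1 \<Longrightarrow> norm (s t x) \<le> w x"
  shows "((\<lambda>t. integral\<^sup>L M (s t)) \<longlongrightarrow> integral\<^sup>L M f) (at_right 0)"
  unfolding filterlim_at_right_to_top
proof (rule integral_dominated_convergence_at_top)
  show "AE x in M. ((\<lambda>t. s (inverse t) x) \<longlongrightarrow> f x) at_top"
    using lim by (simp add: filterlim_at_right_to_top)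
  have "eventually (\<lambda>t::real. 1 < t) at_top" by (rule eventually_gt_at_top)
  then show "\<forall>\<^sub>F t in at_top. AE x in M. norm (s (inverse t) x) \<le> w x"
    by eventually_elim (auto intro!: bound simp: inverse_less_1_iff)
qed (use assms in auto)

lemma integrable_inverse_1_plus_square_real:
  "integrable lborel (\<lambda>x::real. inverse (1 + x\<^sup>2))"
  using integrable_inverse_1_plus_square by (simp add: set_integrable_def)

lemma integrable_of_quadratic_decay:
  fixes f :: "real \<Rightarrow> real"
  assumes "f \<in> borel_measurable borel" and le: "\<And>x. \<bar>f x\<bar> * (1 + x\<^sup>2) \<le> K"
  shows "integrable lborel f"
proof (rule Bochner_Integration.integrable_bound)
  show "integrable lborel (\<lambda>x::real. K * inverse (1 + x\<^sup>2))"
    by (simp add: integrable_inverse_1_plus_square_real)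
  show "AE x in lborel. norm (f x) \<le> norm (K * inverse (1 + x\<^sup>2))"
  proof (rule AE_I2)
    fix x :: real
    have "0 < 1 + x\<^sup>2" by (simp add: add_pos_nonneg)
    then have "\<bar>f x\<bar> \<le> K * inverse (1 + x\<^sup>2)"
      using le[of x] by (simp add: field_simps)
    then show "norm (f x) \<le> norm (K * inverse (1 + x\<^sup>2))" by simp
  qed
qed (use assms in auto)

lemma integral_real_reflect: "(LBINT x::real. f (- x)) = (LBINT x. f x)"
  for f :: "real \<Rightarrow> 'b::{banach, second_countable_topology}"
  using lborel_integral_real_affine[of "-1" f 0] by simp

lemma abs_integral_le:
  fixes f w :: "real \<Rightarrow> real"
  assumes "integrable lborel w" "f \<in> borel_measurable borel" "\<And>x. \<bar>f x\<bar> \<le> w x"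
  shows "\<bar>LBINT x. f x\<bar> \<le> (LBINT x. w x)"
proof -
  have "integrable lborel f"
    by (rule Bochner_Integration.integrable_bound[OF assms(1)])
      (use assms in \<open>auto intro!: order_trans[OF assms(3) abs_ge_self]\<close>)
  then have "(LBINT x. \<bar>f x\<bar>) \<le> (LBINT x. w x)"
    using assms by (intro integral_mono) auto
  then show ?thesis
    using integral_abs_bound[of lborel f] by linarith
qed

section \<open>The regularized distributions\<close>

locale mollifier_function =
  fixes \<eta> :: "real \<Rightarrow> real"
  assumes mollifier: "mollifier \<eta>"
begin

section \<open>Decay and integrability of the mollifier\<close>

lemma even [simp]: "\<eta> (- z) = \<eta> z"
  using mollifier by (simp add: mollifier_def)

lemma integral_eta: "(LBINT z. \<eta> z) = 1"
  using mollifier by (simp add: mollifier_def)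

lemma measurable_eta [measurable]: "\<eta> \<in> borel_measurable borel"
proof (rule borel_measurable_continuous_onI, rule continuous_at_imp_continuous_on, safe)
  \<comment> \<open>The derivative of order 0 is \<open>\<eta>\<close> itself, so the Schwartz
    condition yields its continuity.\<close>
  have "(deriv ^^ 0) \<eta> field_differentiable at x" for x
    using mollifier unfolding mollifier_def schwartz_def by blast
  then show "isCont \<eta> x" for x
    by (simp add: field_differentiable_imp_continuous_at)
qed

lemma power_decay: "\<exists>C. \<forall>x. \<bar>x\<bar> ^ m * \<bar>\<eta> x\<bar> \<le> C"
proof -
  have "bounded (range (\<lambda>x. x ^ m * (deriv ^^ 0) \<eta> x))"
    using mollifier unfolding mollifier_def schwartz_def by blast
  then show ?thesis
    by (auto simp: bounded_iff abs_mult power_abs)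
qed

text \<open>The base is at most \<open>(A + B) * max 1 \<bar>z\<bar>\<close>, and the power of the
  maximum is at most \<open>1 + \<bar>z\<bar> ^ n\<close>; this leaves only the moments of order 0
  and \<open>n\<close>.\<close>

lemma affine_power_decay:
  assumes "0 \<le> A" "0 \<le> B"
  shows "\<exists>C. \<forall>z. (A + B * \<bar>z\<bar>) ^ n * \<bar>\<eta> z\<bar> \<le> C"
proof -
  obtain C0 Cn where C: "\<And>x. \<bar>x\<bar> ^ 0 * \<bar>\<eta> x\<bar> \<le> C0" "\<And>x. \<bar>x\<bar> ^ n * \<bar>\<eta> x\<bar> \<le> Cn"
    using power_decay by meson
  have "(A + B * \<bar>z\<bar>) ^ n * \<bar>\<eta> z\<bar> \<le> (A + B) ^ n * (C0 + Cn)" for z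
  proof -
    have "A + B * \<bar>z\<bar> \<le> A * max 1 \<bar>z\<bar> + B * max 1 \<bar>z\<bar>"
      using assms by (intro add_mono mult_left_mono mult_right_mono mult_left_le) (auto intro: order_trans[OF _ mult_left_mono[of 1]])
    then have "(A + B * \<bar>z\<bar>) ^ n \<le> ((A + B) * max 1 \<bar>z\<bar>) ^ n"
      using assms by (intro power_mono) (auto simp: algebra_simps)
    also have "\<dots> \<le> (A + B) ^ n * (1 + \<bar>z\<bar> ^ n)"
      using assms unfolding power_mult_distrib by (intro mult_left_mono) (auto simp: max_def)
    finally have "(A + B * \<bar>z\<bar>) ^ n * \<bar>\<eta> z\<bar> \<le> (A + B) ^ n * (1 + \<bar>z\<bar> ^ n) * \<bar>\<eta> z\<bar>"
      by (rule mult_right_mono) simp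
    also have "\<dots> = (A + B) ^ n * (\<bar>z\<bar> ^ 0 * \<bar>\<eta> z\<bar> + \<bar>z\<bar> ^ n * \<bar>\<eta> z\<bar>)"
      by (simp add: algebra_simps)
    also have "\<dots> \<le> (A + B) ^ n * (C0 + Cn)"
      using assms by (intro mult_left_mono add_mono C) auto
    finally show ?thesis .
  qed
  then show ?thesis by blast
qed

lemma integrable_affine_power:
  assumes "0 \<le> A" "0 \<le> B"
  shows "integrable lborel (\<lambda>z. (A + B * \<bar>z\<bar>) ^ n * \<bar>\<eta> z\<bar>)"
proof -
  \<comment> \<open>Raising both coefficients by 1 makes the base at least
    \<open>1 + \<bar>z\<bar>\<close>, so the two additional powers dominate the weight
    \<open>1 + z\<^sup>2\<close>.\<close>
  obtain C where C: "\<And>z. ((A + 1) + (B + 1) * \<bar>z\<bar>) ^ (n + 2) * \<bar>\<eta> z\<bar> \<le> C"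
    using affine_power_decay[of "A + 1" "B + 1" "n + 2"] assms by auto
  show ?thesis
  proof (rule integrable_of_quadratic_decay)
    fix z
    have "(A + B * \<bar>z\<bar>) ^ n * (1 + z\<^sup>2) \<le>
        ((A + 1) + (B + 1) * \<bar>z\<bar>) ^ n * ((A + 1) + (B + 1) * \<bar>z\<bar>)\<^sup>2"
    proof (intro mult_mono power_mono)
      have "1 + z\<^sup>2 \<le> (1 + \<bar>z\<bar>)\<^sup>2" by (simp add: power2_eq_square algebra_simps)
      also have "\<dots> \<le> ((A + 1) + (B + 1) * \<bar>z\<bar>)\<^sup>2"
        using assms by (intro power_mono) (auto simp: algebra_simps)
      finally show "1 + z\<^sup>2 \<le> ((A + 1) + (B + 1) * \<bar>z\<bar>)\<^sup>2" .
    qed (use assms in \<open>auto simp: algebra_simps\<close>)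
    then have "(A + B * \<bar>z\<bar>) ^ n * (1 + z\<^sup>2) * \<bar>\<eta> z\<bar> \<le> ((A + 1) + (B + 1) * \<bar>z\<bar>) ^ (n + 2) * \<bar>\<eta> z\<bar>"
      unfolding power_add by (rule mult_right_mono) simp
    also note C[of z]
    finally show "\<bar>(A + B * \<bar>z\<bar>) ^ n * \<bar>\<eta> z\<bar>\<bar> * (1 + z\<^sup>2) \<le> C"
      using assms by (simp add: abs_mult mult_ac)
  qed measurable
qed

lemma integrable_abs_eta: "integrable lborel (\<lambda>z. \<bar>\<eta> z\<bar>)"
  using integrable_affine_power[of 1 0 0] by simp

lemma integrable_eta: "integrable lborel \<eta>"
  using integrable_abs_eta by (rule Bochner_Integration.integrable_bound) auto

lemma eta_bounded: "\<exists>C. \<forall>z. \<bar>\<eta> z\<bar> \<le> C"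
  using power_decay[of 0] by simp

section \<open>Bounds and decay of the regularizations\<close>

definition eta_L1 :: real where "eta_L1 = (LBINT z. \<bar>\<eta> z\<bar>)"

lemma eta_L1_nonneg: "0 \<le> eta_L1"
  by (simp add: eta_L1_def)

lemma Upsilon_eq:
  "Upsilon \<eta> a \<epsilon> n r = (LBINT z. if (a - r) / \<epsilon> \<le> z then \<eta> z / (r + \<epsilon> * z) ^ n else 0)"
  unfolding Upsilon_def set_lebesgue_integral_def
  by (intro Bochner_Integration.integral_cong) (auto split: split_indicator)

lemma measurable_Upsilon [measurable]: "Upsilon \<eta> a \<epsilon> n \<in> borel_measurable borel"
  unfolding Upsilon_eq[abs_def] by measurable

lemma measurable_Upsilon' [measurable]: "Upsilon' \<eta> a \<epsilon> n \<in> borel_measurable borel"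
  unfolding Upsilon'_def[abs_def] by measurable

text \<open>The denominator is at least \<open>a ^ n\<close> on the domain of integration. The bound
  is free of \<open>r\<close> and \<open>\<epsilon>\<close>, so it serves as majorant in the limits
  of \<open>Upsilon\<close>.\<close>

lemma Upsilon_integrand_le:
  assumes "0 < a" "0 < \<epsilon>"
  shows "\<bar>if (a - r) / \<epsilon> \<le> z then \<eta> z / (r + \<epsilon> * z) ^ n else 0\<bar> \<le> \<bar>\<eta> z\<bar> / a ^ n"
proof (cases "(a - r) / \<epsilon> \<le> z")
  case True
  then have "a \<le> r + \<epsilon> * z" using assms by (simp add: field_simps)
  then show ?thesis using assms True
    by (auto simp: abs_mult power_abs intro!: divide_left_mono power_mono mult_pos_pos)
qed (use assms in auto)

lemma abs_Upsilon_le: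
  assumes "0 < a" "0 < \<epsilon>"
  shows "\<bar>Upsilon \<eta> a \<epsilon> n r\<bar> \<le> eta_L1 / a ^ n"
proof -
  have "\<bar>Upsilon \<eta> a \<epsilon> n r\<bar> \<le> (LBINT z. \<bar>\<eta> z\<bar> / a ^ n)"
    unfolding Upsilon_eq
  proof (rule abs_integral_le)
    show "integrable lborel (\<lambda>z. \<bar>\<eta> z\<bar> / a ^ n)" using integrable_abs_eta by simp
  qed (use Upsilon_integrand_le[OF assms] in auto)
  then show ?thesis by (simp add: eta_L1_def)
qed

text \<open>On the domain of integration \<open>a \<le> r + \<epsilon> z\<close>, hence \<open>r \<le> (r + \<epsilon> z) (1 + \<bar>z\<bar> / a)\<close>.\<close>

lemma Upsilon_decay:
  assumes a: "0 < a"
  shows "\<exists>K. \<forall>\<epsilon> r. 0 < \<epsilon> \<longrightarrow> \<epsilon> < 1 \<longrightarrow> 0 \<le> r \<longrightarrow> \<bar>Upsilon \<eta> a \<epsilon> n r\<bar> * (1 + r ^ n) \<le> K"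
proof -
  define W where "W = (LBINT z. (1 + 1 / a * \<bar>z\<bar>) ^ n * \<bar>\<eta> z\<bar>)"
  have int: "integrable lborel (\<lambda>z. (1 + 1 / a * \<bar>z\<bar>) ^ n * \<bar>\<eta> z\<bar>)"
    using a by (intro integrable_affine_power) auto
  have "\<bar>Upsilon \<eta> a \<epsilon> n r\<bar> * (1 + r ^ n) \<le> eta_L1 / a ^ n + W"
    if \<epsilon>: "0 < \<epsilon>" "\<epsilon> < 1" and r: "0 \<le> r" for \<epsilon> r
  proof -
    have "\<bar>r ^ n * (if (a - r) / \<epsilon> \<le> z then \<eta> z / (r + \<epsilon> * z) ^ n else 0)\<bar>
        \<le> (1 + 1 / a * \<bar>z\<bar>) ^ n * \<bar>\<eta> z\<bar>" for z
    proof (cases "(a - r) / \<epsilon> \<le> z")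
      case True
      then have le: "a \<le> r + \<epsilon> * z" using \<epsilon> by (simp add: field_simps)
      \<comment> \<open>Here \<open>\<epsilon> < 1\<close> makes the estimate uniform in
        \<open>\<epsilon>\<close>.\<close>
      have "\<bar>\<epsilon> * z\<bar> \<le> \<bar>z\<bar>" using \<epsilon> by (simp add: abs_mult mult_left_le_one_le)
      then have "r \<le> (r + \<epsilon> * z) + \<bar>z\<bar>" by linarith
      \<comment> \<open>This is \<open>a \<le> r + \<epsilon> * z\<close> multiplied by
        \<open>\<bar>z\<bar> / a\<close>.\<close>
      also have "\<bar>z\<bar> \<le> (r + \<epsilon> * z) * (1 / a * \<bar>z\<bar>)"
        using mult_right_mono[OF le, of "1 / a * \<bar>z\<bar>"] a by simp
      finally have "r \<le> (r + \<epsilon> * z) * (1 + 1 / a * \<bar>z\<bar>)"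
        by (simp add: algebra_simps)
      then have "r ^ n \<le> (r + \<epsilon> * z) ^ n * (1 + 1 / a * \<bar>z\<bar>) ^ n"
        unfolding power_mult_distrib[symmetric] using r by (rule power_mono)
      then have "r ^ n / (r + \<epsilon> * z) ^ n \<le> (1 + 1 / a * \<bar>z\<bar>) ^ n"
        using le a by (simp add: field_simps)
      then have "r ^ n / (r + \<epsilon> * z) ^ n * \<bar>\<eta> z\<bar> \<le> (1 + 1 / a * \<bar>z\<bar>) ^ n * \<bar>\<eta> z\<bar>"
        by (rule mult_right_mono) simp
      then show ?thesis using True le a r by (simp add: abs_mult)
    qed (use a in auto)
    then have "\<bar>LBINT z. r ^ n * (if (a - r) / \<epsilon> \<le> z then \<eta> z / (r + \<epsilon> * z) ^ n else 0)\<bar> \<le> W"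
      unfolding W_def by (intro abs_integral_le[OF int]) auto
    then have "r ^ n * \<bar>Upsilon \<eta> a \<epsilon> n r\<bar> \<le> W"
      using r unfolding Upsilon_eq by (simp add: abs_mult)
    then show ?thesis
      using abs_Upsilon_le[OF a \<epsilon>(1), of n r] by (simp add: algebra_simps)
  qed
  then show ?thesis by blast
qed

text \<open>Since \<open>\<eta>\<close> decays rapidly, the order \<open>m\<close> can be chosen
  independently of \<open>n\<close>. The constant depends on \<open>\<epsilon>\<close>, so this
  serves integrability at fixed \<open>\<epsilon>\<close>, not the passage to the limit.\<close>

lemma Upsilon'_decay:
  assumes a: "0 < a" and \<epsilon>: "0 < \<epsilon>"
  shows "\<exists>K. \<forall>r\<ge>0. \<bar>Upsilon' \<eta> a \<epsilon> n r\<bar> * (1 + r ^ m) \<le> K"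
proof -
  \<comment> \<open>With \<open>1 + a\<close> in place of \<open>a\<close> the base is at least 1,
    so its power dominates the summand 1 of the weight as well as \<open>r ^ m\<close>.\<close>
  obtain C where C: "\<And>z. ((1 + a) + \<epsilon> * \<bar>z\<bar>) ^ m * \<bar>\<eta> z\<bar> \<le> C"
    using affine_power_decay[of "1 + a" \<epsilon> m] assms by auto
  have "\<bar>Upsilon' \<eta> a \<epsilon> n r\<bar> * (1 + r ^ m) \<le> 1 / (a ^ n * \<epsilon>) * (2 * C)" if r: "0 \<le> r" for r
  proof -
    let ?z = "(a - r) / \<epsilon>"
    have "r = a - \<epsilon> * ?z" using \<epsilon> by simp
    moreover have "- (\<epsilon> * ?z) \<le> \<epsilon> * \<bar>?z\<bar>"
      using \<epsilon> abs_ge_minus_self[of "\<epsilon> * ?z"] by (simp only: abs_mult abs_of_pos)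
    ultimately have "r \<le> (1 + a) + \<epsilon> * \<bar>?z\<bar>" by linarith
    then have "r ^ m \<le> ((1 + a) + \<epsilon> * \<bar>?z\<bar>) ^ m"
      using r by (rule power_mono)
    moreover have "1 \<le> ((1 + a) + \<epsilon> * \<bar>?z\<bar>) ^ m"
      using a \<epsilon> by (intro one_le_power) auto
    ultimately have "1 + r ^ m \<le> 2 * ((1 + a) + \<epsilon> * \<bar>?z\<bar>) ^ m" by simp
    then have "\<bar>\<eta> ?z\<bar> * (1 + r ^ m) \<le> \<bar>\<eta> ?z\<bar> * (2 * ((1 + a) + \<epsilon> * \<bar>?z\<bar>) ^ m)"
      by (rule mult_left_mono) simp
    also have "\<dots> \<le> 2 * C" using C[of ?z] by (simp add: mult_ac)
    finally have "1 / (a ^ n * \<epsilon>) * (\<bar>\<eta> ?z\<bar> * (1 + r ^ m)) \<le> 1 / (a ^ n * \<epsilon>) * (2 * C)"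
      using a \<epsilon> by (intro mult_left_mono) auto
    then show ?thesis using a \<epsilon> by (simp add: Upsilon'_def abs_mult)
  qed
  then show ?thesis by blast
qed

end

section \<open>Products of decaying functions on the half-line\<close>

lemma abs_product_decay:
  fixes r x y :: real
  assumes "0 \<le> r" "\<bar>x\<bar> * (1 + r\<^sup>2) \<le> K" "\<bar>y\<bar> * (1 + r ^ 3) \<le> K'" "k \<in> {2, 3}"
  shows "\<bar>r ^ k * (x * y)\<bar> * (1 + r\<^sup>2) \<le> K * K'"
proof -
  \<comment> \<open>The weight of \<open>y\<close> thus absorbs \<open>r ^ k\<close>, while the
    weight of \<open>x\<close> is left over as the integrable quadratic decay.\<close>
  have "r ^ k \<le> 1 + r ^ 3"
  proof (cases "r \<le> 1")
    case True
    then have "r ^ k \<le> 1" using assms by (simp add: power_le_one)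
    then show ?thesis using assms by (simp add: add_increasing2)
  next
    case False
    then have "r ^ k \<le> r ^ 3" using assms by (intro power_increasing) auto
    then show ?thesis by simp
  qed
  then have "\<bar>y\<bar> * r ^ k \<le> \<bar>y\<bar> * (1 + r ^ 3)"
    by (rule mult_left_mono) simp
  also note assms(3)
  finally have y: "\<bar>y\<bar> * r ^ k \<le> K'" .
  have "0 \<le> \<bar>x\<bar> * (1 + r\<^sup>2)" by simp
  then have "0 \<le> K" using assms(2) by linarith
  have "\<bar>r ^ k * (x * y)\<bar> * (1 + r\<^sup>2) = (\<bar>x\<bar> * (1 + r\<^sup>2)) * (\<bar>y\<bar> * r ^ k)"
    using assms(1) by (simp add: abs_mult mult_ac)
  also have "\<dots> \<le> K * K'"
    using assms(1) \<open>0 \<le> K\<close> by (intro mult_mono assms(2) y) auto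
  finally show ?thesis .
qed

lemma integrable_radial_product:
  fixes f g :: "real \<Rightarrow> real"
  assumes [measurable]: "f \<in> borel_measurable borel" "g \<in> borel_measurable borel"
    and f: "\<exists>K. \<forall>r\<ge>0. \<bar>f r\<bar> * (1 + r\<^sup>2) \<le> K" and g: "\<exists>K. \<forall>r\<ge>0. \<bar>g r\<bar> * (1 + r ^ 3) \<le> K"
    and k: "k \<in> {2, 3}"
  shows "integrable lborel (\<lambda>r. indicator {0<..} r * (r ^ k * (f r * g r)))"
proof -
  obtain K K' where K: "\<And>r. 0 \<le> r \<Longrightarrow> \<bar>f r\<bar> * (1 + r\<^sup>2) \<le> K" "\<And>r. 0 \<le> r \<Longrightarrow> \<bar>g r\<bar> * (1 + r ^ 3) \<le> K'"
    using f g by blast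
  \<comment> \<open>The sign of the constant, read off at radius 0, is what the bound amounts to
    where the indicator vanishes.\<close>
  have "0 \<le> \<bar>r ^ k * (f r * g r)\<bar> * (1 + r\<^sup>2)" for r by simp
  then have "0 \<le> K * K'"
    using abs_product_decay[OF order_refl K(1) K(2) k] order_trans by blast
  show ?thesis
  proof (rule integrable_of_quadratic_decay)
    fix r :: real
    show "\<bar>indicator {0<..} r * (r ^ k * (f r * g r))\<bar> * (1 + r\<^sup>2) \<le> K * K'"
    proof (cases "0 < r")
      case True
      then show ?thesis using abs_product_decay[OF _ K(1) K(2) k, of r] by simp
    qed (use \<open>0 \<le> K * K'\<close> in simp)
  qed measurable
qed

lemma decay_diff:
  fixes f g :: "real \<Rightarrow> real"
  assumes f: "\<exists>K. \<forall>r\<ge>0. \<bar>f r\<bar> * (1 + r ^ n) \<le> K" and g: "\<exists>K. \<forall>r\<ge>0. \<bar>g r\<bar> * (1 + r ^ n) \<le> K"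
  shows "\<exists>K. \<forall>r\<ge>0. \<bar>f r - g r\<bar> * (1 + r ^ n) \<le> K"
proof -
  obtain K K' where K: "\<And>r. 0 \<le> r \<Longrightarrow> \<bar>f r\<bar> * (1 + r ^ n) \<le> K"
      "\<And>r. 0 \<le> r \<Longrightarrow> \<bar>g r\<bar> * (1 + r ^ n) \<le> K'"
    using f g by blast
  have "\<bar>f r - g r\<bar> * (1 + r ^ n) \<le> K + K'" if "0 \<le> r" for r
  proof -
    have "\<bar>f r - g r\<bar> * (1 + r ^ n) \<le> (\<bar>f r\<bar> + \<bar>g r\<bar>) * (1 + r ^ n)"
      using that by (intro mult_right_mono) auto
    then show ?thesis
      using K[OF that] by (simp add: distrib_right)
  qed
  then show ?thesis by blast
qed

lemma integral_inverse_square_atLeast: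
  fixes a :: real
  assumes "0 < a"
  shows "(LBINT r. indicator {a..} r * (1 / r\<^sup>2)) = 1 / a"
proof -
  have "((\<lambda>x::real. - (1 / x)) \<longlongrightarrow> 0) at_top"
    by real_asymp
  then have "(\<integral>\<^sup>+r. ennreal (1 / r\<^sup>2) * indicator {a..} r \<partial>lborel) = ennreal (0 - (- (1 / a)))"
    using assms
    by (intro nn_integral_FTC_atLeast)
      (auto intro!: derivative_eq_intros simp: power2_eq_square)
  also have "(\<integral>\<^sup>+r. ennreal (1 / r\<^sup>2) * indicator {a..} r \<partial>lborel) =
      (\<integral>\<^sup>+r. ennreal (indicator {a..} r * (1 / r\<^sup>2)) \<partial>lborel)"
    by (intro nn_integral_cong) (auto split: split_indicator)
  finally show ?thesis
    using assms by (subst integral_eq_nn_integral) auto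
qed

section \<open>Limits of the radial integrals as \<open>\<epsilon>\<close> tends to 0\<close>

context mollifier_function
begin

text \<open>The profile of the mollified step in the layer \<open>r = a + \<epsilon> * w\<close>.
  Because \<open>\<eta>\<close> is even, it is the primitive of \<open>\<eta>\<close> that vanishes
  at minus infinity; integrating over \<open>z \<ge> - w\<close> matches the lower limit in
  \<open>Upsilon\<close>.\<close>

definition Theta :: "real \<Rightarrow> real" where
  "Theta w = (LBINT z. if - w \<le> z then \<eta> z else 0)"

lemma measurable_Theta [measurable]: "Theta \<in> borel_measurable borel"
  unfolding Theta_def[abs_def] by measurable

lemma abs_Theta_le: "\<bar>Theta w\<bar> \<le> eta_L1"
  unfolding Theta_def eta_L1_def by (intro abs_integral_le integrable_abs_eta) auto

lemma integrable_half_eta: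
  "integrable lborel (\<lambda>z. if P z then \<eta> z else 0)" if [measurable]: "Measurable.pred borel P"
  by (rule Bochner_Integration.integrable_bound[OF integrable_eta]) auto

text \<open>By evenness the half-line \<open>z \<ge> w\<close> may be replaced by
  \<open>z \<le> - w\<close>, which complements \<open>z \<ge> - w\<close> up to the common
  endpoint, a null set. The total mass is 1.\<close>

lemma Theta_minus: "Theta (- w) = 1 - Theta w"
proof -
  have "Theta (- w) = (LBINT z. if w \<le> - z then \<eta> (- z) else 0)"
    unfolding Theta_def by (subst integral_real_reflect[symmetric]) simp
  also have "\<dots> = (LBINT z. \<eta> z - (if - w \<le> z then \<eta> z else 0))"
  proof (rule integral_cong_AE)
    show "AE z in lborel. (if w \<le> - z then \<eta> (- z) else 0) = \<eta> z - (if - w \<le> z then \<eta> z else 0)"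
      using AE_lborel_singleton[of "- w"] by eventually_elim auto
  qed measurable
  also have "\<dots> = 1 - Theta w"
    unfolding Theta_def
    by (subst Bochner_Integration.integral_diff)
      (auto simp: integral_eta integrable_eta integrable_half_eta)
  finally show ?thesis .
qed

text \<open>Reflecting \<open>w\<close> and using \<open>Theta_minus\<close> shows that the integral
  \<open>I\<close> satisfies \<open>I = 1 - I\<close>.\<close>

lemma integral_eta_Theta: "(LBINT w. \<eta> w * Theta w) = 1 / 2"
proof -
  have int: "integrable lborel (\<lambda>w. \<eta> w * Theta w)"
  proof (rule Bochner_Integration.integrable_bound)
    show "integrable lborel (\<lambda>w. \<bar>\<eta> w\<bar> * eta_L1)"
      using integrable_abs_eta by simp
    show "AE w in lborel. norm (\<eta> w * Theta w) \<le> norm (\<bar>\<eta> w\<bar> * eta_L1)"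
      using abs_Theta_le eta_L1_nonneg by (intro AE_I2) (auto simp: abs_mult intro!: mult_left_mono)
  qed measurable
  have "(LBINT w. \<eta> w * Theta w) = (LBINT w. \<eta> w - \<eta> w * Theta w)"
    by (subst integral_real_reflect[symmetric]) (simp add: Theta_minus algebra_simps)
  also have "\<dots> = 1 - (LBINT w. \<eta> w * Theta w)"
    using int integrable_eta by (simp add: integral_eta)
  finally show ?thesis by simp
qed

text \<open>In the variable \<open>w\<close> the lower limit of integration is \<open>- w\<close>
  for every positive \<open>\<epsilon>\<close>, so only the denominator moves, and it tends to
  \<open>a ^ n\<close>.\<close>

lemma tendsto_Upsilon_shift:
  assumes a: "0 < a"
  shows "((\<lambda>\<epsilon>. Upsilon \<eta> a \<epsilon> n (a + \<epsilon> * w)) \<longlongrightarrow> Theta w / a ^ n) (at_right 0)"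
proof -
  have shift: "(a - (a + \<epsilon> * w)) / \<epsilon> = - w" if "0 < \<epsilon>" for \<epsilon>
    using that by (simp add: field_simps)
  have "((\<lambda>\<epsilon>. LBINT z. if - w \<le> z then \<eta> z / (a + \<epsilon> * w + \<epsilon> * z) ^ n else 0) \<longlongrightarrow>
      (LBINT z. (if - w \<le> z then \<eta> z else 0) / a ^ n)) (at_right 0)"
  proof (rule dominated_convergence_at_right_0)
    show "integrable lborel (\<lambda>z. \<bar>\<eta> z\<bar> / a ^ n)" using integrable_abs_eta by simp
    show "norm (if - w \<le> z then \<eta> z / (a + \<epsilon> * w + \<epsilon> * z) ^ n else 0) \<le> \<bar>\<eta> z\<bar> / a ^ n"
      if "0 < \<epsilon>" for \<epsilon> z
      using Upsilon_integrand_le[OF a that, of "a + \<epsilon> * w" z n] shift[OF that] by simp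
    show "AE z in lborel. ((\<lambda>\<epsilon>. if - w \<le> z then \<eta> z / (a + \<epsilon> * w + \<epsilon> * z) ^ n else 0) \<longlongrightarrow>
        (if - w \<le> z then \<eta> z else 0) / a ^ n) (at_right 0)"
      using a by (intro AE_I2) (auto intro!: tendsto_eq_intros)
  qed auto
  also have "(LBINT z. (if - w \<le> z then \<eta> z else 0) / a ^ n) = Theta w / a ^ n"
    by (simp add: Theta_def)
  finally show ?thesis
  proof (rule Lim_transform_eventually)
    show "\<forall>\<^sub>F \<epsilon> in at_right 0. (LBINT z. if - w \<le> z then \<eta> z / (a + \<epsilon> * w + \<epsilon> * z) ^ n else 0) =
        Upsilon \<eta> a \<epsilon> n (a + \<epsilon> * w)"
      using eventually_at_right_less[of 0]
    proof eventually_elim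
      case (elim \<epsilon>)
      then show ?case using shift[OF elim] by (simp add: Upsilon_eq)
    qed
  qed
qed

text \<open>Away from the jump the domain of integration fills the whole line if
  \<open>a < r\<close> and disappears if \<open>r < a\<close>, because \<open>\<epsilon> * z\<close>
  tends to 0 for each \<open>z\<close>. The unit mass of \<open>\<eta>\<close> gives the
  value.\<close>

lemma tendsto_Upsilon:
  assumes a: "0 < a" and r: "r \<noteq> a"
  shows "((\<lambda>\<epsilon>. Upsilon \<eta> a \<epsilon> n r) \<longlongrightarrow> (if a < r then 1 / r ^ n else 0)) (at_right 0)"
proof -
  have "((\<lambda>\<epsilon>. Upsilon \<eta> a \<epsilon> n r) \<longlongrightarrow> (LBINT z. if a < r then \<eta> z / r ^ n else 0)) (at_right 0)"
    unfolding Upsilon_eq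
  proof (rule dominated_convergence_at_right_0)
    show "integrable lborel (\<lambda>z. \<bar>\<eta> z\<bar> / a ^ n)" using integrable_abs_eta by simp
    show "norm (if (a - r) / \<epsilon> \<le> z then \<eta> z / (r + \<epsilon> * z) ^ n else 0) \<le> \<bar>\<eta> z\<bar> / a ^ n"
      if "0 < \<epsilon>" for \<epsilon> z
      using Upsilon_integrand_le[OF a that] by simp
    have "((\<lambda>\<epsilon>. if (a - r) / \<epsilon> \<le> z then \<eta> z / (r + \<epsilon> * z) ^ n else 0) \<longlongrightarrow>
        (if a < r then \<eta> z / r ^ n else 0)) (at_right 0)" for z
    proof -
      have lim: "((\<lambda>\<epsilon>. \<epsilon> * z) \<longlongrightarrow> 0) (at_right 0)"
        by (auto intro!: tendsto_eq_intros)
      show ?thesis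
      proof (cases "a < r")
        case True
        have "((\<lambda>\<epsilon>. \<eta> z / (r + \<epsilon> * z) ^ n) \<longlongrightarrow> \<eta> z / r ^ n) (at_right 0)"
          using True a by (auto intro!: tendsto_eq_intros)
        moreover have "\<forall>\<^sub>F \<epsilon> in at_right 0. a - r < \<epsilon> * z"
          using True by (intro order_tendstoD(1)[OF lim]) simp
        then have "\<forall>\<^sub>F \<epsilon> in at_right 0. \<eta> z / (r + \<epsilon> * z) ^ n =
            (if (a - r) / \<epsilon> \<le> z then \<eta> z / (r + \<epsilon> * z) ^ n else 0)"
          using eventually_at_right_less[of 0]
          by eventually_elim (auto simp: field_simps)
        ultimately show ?thesis
          using True by (simp add: Lim_transform_eventually)
      next
        case False
        then have "\<forall>\<^sub>F \<epsilon> in at_right 0. \<epsilon> * z < a - r"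
          using r by (intro order_tendstoD(2)[OF lim]) simp
        then have "\<forall>\<^sub>F \<epsilon> in at_right 0. 0 =
            (if (a - r) / \<epsilon> \<le> z then \<eta> z / (r + \<epsilon> * z) ^ n else 0)"
          using eventually_at_right_less[of 0]
          by eventually_elim (auto simp: field_simps)
        then show ?thesis
          using False by (simp add: Lim_transform_eventually[OF tendsto_const])
      qed
    qed
    then show "AE z in lborel. ((\<lambda>\<epsilon>. if (a - r) / \<epsilon> \<le> z then \<eta> z / (r + \<epsilon> * z) ^ n else 0) \<longlongrightarrow>
        (if a < r then \<eta> z / r ^ n else 0)) (at_right 0)" by simp
  qed auto
  then show ?thesis by (cases "a < r") (simp_all add: integral_eta)
qed

text \<open>No boundary layer contributes: the decay is uniform in \<open>\<epsilon>\<close> and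
  provides a majorant, and off the null set \<open>r = a\<close> the integrand tends to
  \<open>1 / r\<^sup>2\<close> beyond \<open>a\<close> and to 0 before it.\<close>

lemma tendsto_Upsilon_Upsilon:
  assumes a: "0 < a"
  shows "((\<lambda>\<epsilon>. LBINT r. indicator {0<..} r * (r ^ 3 * (Upsilon \<eta> a \<epsilon> 2 r * Upsilon \<eta> a \<epsilon> 3 r)))
    \<longlongrightarrow> 1 / a) (at_right 0)"
proof -
  obtain K2 K3 where K:
      "\<And>\<epsilon> r. 0 < \<epsilon> \<Longrightarrow> \<epsilon> < 1 \<Longrightarrow> 0 \<le> r \<Longrightarrow> \<bar>Upsilon \<eta> a \<epsilon> 2 r\<bar> * (1 + r\<^sup>2) \<le> K2"
      "\<And>\<epsilon> r. 0 < \<epsilon> \<Longrightarrow> \<epsilon> < 1 \<Longrightarrow> 0 \<le> r \<Longrightarrow> \<bar>Upsilon \<eta> a \<epsilon> 3 r\<bar> * (1 + r ^ 3) \<le> K3"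
    using Upsilon_decay[OF a, of 2] Upsilon_decay[OF a, of 3] by blast
  have "((\<lambda>\<epsilon>. LBINT r. indicator {0<..} r * (r ^ 3 * (Upsilon \<eta> a \<epsilon> 2 r * Upsilon \<eta> a \<epsilon> 3 r)))
    \<longlongrightarrow> (LBINT r. indicator {a..} r * (1 / r\<^sup>2))) (at_right 0)"
  proof (rule dominated_convergence_at_right_0)
    show "integrable lborel (\<lambda>r::real. \<bar>K2 * K3\<bar> * inverse (1 + r\<^sup>2))"
      by (simp add: integrable_inverse_1_plus_square_real)
    show "norm (indicator {0<..} r * (r ^ 3 * (Upsilon \<eta> a \<epsilon> 2 r * Upsilon \<eta> a \<epsilon> 3 r)))
        \<le> \<bar>K2 * K3\<bar> * inverse (1 + r\<^sup>2)" if "0 < \<epsilon>" "\<epsilon> < 1" for \<epsilon> r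
    proof (cases "0 < r")
      case True
      have "\<bar>r ^ 3 * (Upsilon \<eta> a \<epsilon> 2 r * Upsilon \<eta> a \<epsilon> 3 r)\<bar> * (1 + r\<^sup>2) \<le> K2 * K3"
        using True that by (intro abs_product_decay K) auto
      also have "\<dots> \<le> \<bar>K2 * K3\<bar>" by simp
      finally show ?thesis using True by (simp add: field_simps add_pos_nonneg)
    qed simp
    have lim: "((\<lambda>\<epsilon>. indicator {0<..} r * (r ^ 3 * (Upsilon \<eta> a \<epsilon> 2 r * Upsilon \<eta> a \<epsilon> 3 r))) \<longlongrightarrow>
        indicator {a..} r * (1 / r\<^sup>2)) (at_right 0)" if "r \<noteq> a" for r
    proof -
      have "((\<lambda>\<epsilon>. indicator {0<..} r * (r ^ 3 * (Upsilon \<eta> a \<epsilon> 2 r * Upsilon \<eta> a \<epsilon> 3 r))) \<longlongrightarrow>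
          indicator {0<..} r * (r ^ 3 * ((if a < r then 1 / r\<^sup>2 else 0) * (if a < r then 1 / r ^ 3 else 0))))
          (at_right 0)"
        by (intro tendsto_intros tendsto_Upsilon a that)
      also have "indicator {0<..} r * (r ^ 3 * ((if a < r then 1 / r\<^sup>2 else 0) * (if a < r then 1 / r ^ 3 else 0)))
          = indicator {a..} r * (1 / r\<^sup>2)"
        using a that
        by (auto simp: power2_eq_square power3_eq_cube field_simps split: split_indicator)
      finally show ?thesis .
    qed
    show "AE r in lborel. ((\<lambda>\<epsilon>. indicator {0<..} r * (r ^ 3 * (Upsilon \<eta> a \<epsilon> 2 r * Upsilon \<eta> a \<epsilon> 3 r))) \<longlongrightarrow>
        indicator {a..} r * (1 / r\<^sup>2)) (at_right 0)"
      using AE_lborel_singleton[of a] by eventually_elim (rule lim)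
  qed auto
  then show ?thesis by (simp only: integral_inverse_square_atLeast[OF a])
qed

text \<open>Substituting \<open>r = a + \<epsilon> * w\<close> produces a Jacobian
  \<open>\<epsilon>\<close> that cancels the factor \<open>1 / \<epsilon>\<close> of the mollified
  delta.\<close>

lemma integral_Upsilon'_subst:
  assumes \<epsilon>: "0 < \<epsilon>"
  shows "(LBINT r. indicator {0<..} r * (r ^ 3 * (Upsilon' \<eta> a \<epsilon> m r * g r))) =
    1 / a ^ m * (LBINT w. indicator {0<..} (a + \<epsilon> * w) * (a + \<epsilon> * w) ^ 3 * (\<eta> w * g (a + \<epsilon> * w)))"
proof -
  have "(a - (a + \<epsilon> * w)) / \<epsilon> = - w" for w
    using \<epsilon> by (simp add: field_simps)
  then have U: "Upsilon' \<eta> a \<epsilon> m (a + \<epsilon> * w) = 1 / (a ^ m * \<epsilon>) * \<eta> w" for w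
    by (simp add: Upsilon'_def)
  have "(LBINT r. indicator {0<..} r * (r ^ 3 * (Upsilon' \<eta> a \<epsilon> m r * g r))) =
    \<bar>\<epsilon>\<bar> *\<^sub>R (LBINT w. indicator {0<..} (a + \<epsilon> * w) *
      ((a + \<epsilon> * w) ^ 3 * (Upsilon' \<eta> a \<epsilon> m (a + \<epsilon> * w) * g (a + \<epsilon> * w))))"
    using \<epsilon> by (intro lborel_integral_real_affine) simp
  also have "\<dots> = (LBINT w. \<epsilon> * (indicator {0<..} (a + \<epsilon> * w) *
      ((a + \<epsilon> * w) ^ 3 * (Upsilon' \<eta> a \<epsilon> m (a + \<epsilon> * w) * g (a + \<epsilon> * w)))))"
    using \<epsilon> by simp
  also have "\<dots> = (LBINT w. 1 / a ^ m * (indicator {0<..} (a + \<epsilon> * w) * (a + \<epsilon> * w) ^ 3 *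
      (\<eta> w * g (a + \<epsilon> * w))))"
    unfolding U using \<epsilon> by (intro Bochner_Integration.integral_cong) (auto simp: field_simps)
  finally show ?thesis by simp
qed

text \<open>The literal factor 1 keeps the majorant in the shape of
  \<open>integrable_affine_power\<close>.\<close>

lemma abs_affine_power_le:
  fixes a \<epsilon> w :: real
  assumes "0 < a" "0 < \<epsilon>" "\<epsilon> < 1"
  shows "\<bar>indicator {0<..} (a + \<epsilon> * w) * (a + \<epsilon> * w) ^ 3\<bar> \<le> (a + 1 * \<bar>w\<bar>) ^ 3"
proof -
  have "\<bar>\<epsilon> * w\<bar> \<le> \<bar>w\<bar>" using assms by (simp add: abs_mult mult_left_le_one_le)
  then have "\<bar>a + \<epsilon> * w\<bar> \<le> a + 1 * \<bar>w\<bar>" using assms by linarith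
  then have "\<bar>a + \<epsilon> * w\<bar> ^ 3 \<le> (a + 1 * \<bar>w\<bar>) ^ 3" by (rule power_mono) simp
  then show ?thesis using assms by (auto simp: abs_mult power_abs split: split_indicator)
qed

lemma eventually_shift_pos:
  assumes "0 < a"
  shows "\<forall>\<^sub>F \<epsilon> in at_right 0. 0 < a + \<epsilon> * (w :: real)"
proof -
  have "((\<lambda>\<epsilon>. a + \<epsilon> * w) \<longlongrightarrow> a) (at_right 0)" by (auto intro!: tendsto_eq_intros)
  then show ?thesis using assms by (rule order_tendstoD(1))
qed

text \<open>The mollified delta concentrates at the jump of the mollified step, so the limit is
  taken in the layer variable \<open>w\<close>, where the integral of
  \<open>\<eta> w * Theta w\<close> supplies the factor 1/2.\<close>

lemma tendsto_Upsilon'_Upsilon: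
  assumes a: "0 < a"
  shows "((\<lambda>\<epsilon>. LBINT r. indicator {0<..} r * (r ^ 3 * (Upsilon' \<eta> a \<epsilon> m r * Upsilon \<eta> a \<epsilon> n r)))
    \<longlongrightarrow> a ^ 3 / (2 * a ^ (m + n))) (at_right 0)"
proof -
  have "((\<lambda>\<epsilon>. LBINT w. indicator {0<..} (a + \<epsilon> * w) * (a + \<epsilon> * w) ^ 3 *
        (\<eta> w * Upsilon \<eta> a \<epsilon> n (a + \<epsilon> * w)))
      \<longlongrightarrow> (LBINT w. a ^ 3 * (\<eta> w * (Theta w / a ^ n)))) (at_right 0)"
  proof (rule dominated_convergence_at_right_0)
    show "integrable lborel (\<lambda>w. (a + 1 * \<bar>w\<bar>) ^ 3 * \<bar>\<eta> w\<bar> * (eta_L1 / a ^ n))"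
      using integrable_affine_power[of a 1 3] a by (intro integrable_mult_left) auto
    show "norm (indicator {0<..} (a + \<epsilon> * w) * (a + \<epsilon> * w) ^ 3 *
        (\<eta> w * Upsilon \<eta> a \<epsilon> n (a + \<epsilon> * w))) \<le> (a + 1 * \<bar>w\<bar>) ^ 3 * \<bar>\<eta> w\<bar> * (eta_L1 / a ^ n)"
      if "0 < \<epsilon>" "\<epsilon> < 1" for \<epsilon> w
      using mult_mono[OF abs_affine_power_le[OF a that, of w]
          mult_left_mono[OF abs_Upsilon_le[OF a that(1), of n "a + \<epsilon> * w"], of "\<bar>\<eta> w\<bar>"]] a
      by (simp add: abs_mult mult_ac)
    have "((\<lambda>\<epsilon>. indicator {0<..} (a + \<epsilon> * w) * (a + \<epsilon> * w) ^ 3 *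
        (\<eta> w * Upsilon \<eta> a \<epsilon> n (a + \<epsilon> * w))) \<longlongrightarrow> a ^ 3 * (\<eta> w * (Theta w / a ^ n))) (at_right 0)" for w
    proof (rule Lim_transform_eventually)
      have "((\<lambda>\<epsilon>. a + \<epsilon> * w) \<longlongrightarrow> a) (at_right 0)" by (auto intro!: tendsto_eq_intros)
      then show "((\<lambda>\<epsilon>. (a + \<epsilon> * w) ^ 3 * (\<eta> w * Upsilon \<eta> a \<epsilon> n (a + \<epsilon> * w))) \<longlongrightarrow>
          a ^ 3 * (\<eta> w * (Theta w / a ^ n))) (at_right 0)"
        by (intro tendsto_intros tendsto_Upsilon_shift a)
      show "\<forall>\<^sub>F \<epsilon> in at_right 0. (a + \<epsilon> * w) ^ 3 * (\<eta> w * Upsilon \<eta> a \<epsilon> n (a + \<epsilon> * w)) =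
          indicator {0<..} (a + \<epsilon> * w) * (a + \<epsilon> * w) ^ 3 * (\<eta> w * Upsilon \<eta> a \<epsilon> n (a + \<epsilon> * w))"
        using eventually_shift_pos[OF a, of w] by eventually_elim simp
    qed
    then show "AE w in lborel. ((\<lambda>\<epsilon>. indicator {0<..} (a + \<epsilon> * w) * (a + \<epsilon> * w) ^ 3 *
        (\<eta> w * Upsilon \<eta> a \<epsilon> n (a + \<epsilon> * w))) \<longlongrightarrow> a ^ 3 * (\<eta> w * (Theta w / a ^ n))) (at_right 0)"
      by simp
  qed measurable
  also have "(LBINT w. a ^ 3 * (\<eta> w * (Theta w / a ^ n))) = (LBINT w. a ^ 3 / a ^ n * (\<eta> w * Theta w))"
    by (intro Bochner_Integration.integral_cong) auto
  also have "\<dots> = a ^ 3 / a ^ n * (1 / 2)"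
    by (simp only: integral_mult_right_zero integral_eta_Theta)
  finally have "((\<lambda>\<epsilon>. 1 / a ^ m * (LBINT w. indicator {0<..} (a + \<epsilon> * w) * (a + \<epsilon> * w) ^ 3 *
        (\<eta> w * Upsilon \<eta> a \<epsilon> n (a + \<epsilon> * w))))
      \<longlongrightarrow> 1 / a ^ m * (a ^ 3 / a ^ n * (1 / 2))) (at_right 0)"
    by (intro tendsto_intros)
  also have "1 / a ^ m * (a ^ 3 / a ^ n * (1 / 2)) = a ^ 3 / (2 * a ^ (m + n))"
    by (simp add: power_add)
  finally show ?thesis
    by (rule Lim_transform_eventually)
      (use eventually_at_right_less[of 0] in \<open>eventually_elim, simp only: integral_Upsilon'_subst\<close>)
qed

text \<open>For \<open>a + \<epsilon> * w > 0\<close> the cube is expanded and each term is bounded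
  by a power of \<open>t = \<bar>w\<bar> / a\<close>. Otherwise the quotient is
  \<open>- 1 / \<epsilon>\<close>, but then \<open>\<epsilon> * \<bar>w\<bar> \<ge> a\<close>, so
  \<open>1 / \<epsilon> \<le> t\<close>: cutting off at the origin costs no more than the
  expansion.\<close>

lemma abs_cubic_difference_quotient_le:
  fixes a \<epsilon> w :: real
  assumes a: "0 < a" and \<epsilon>: "0 < \<epsilon>" "\<epsilon> < 1"
  shows "\<bar>(indicator {0<..} (a + \<epsilon> * w) * (a + \<epsilon> * w) ^ 3 / a ^ 3 - 1) / \<epsilon>\<bar> \<le> (1 + 1 / a * \<bar>w\<bar>) ^ 3"
proof -
  define t where "t = \<bar>w\<bar> / a"
  have t: "0 \<le> t" using a by (simp add: t_def)
  have exp: "(1 + t) ^ 3 = 1 + 3 * t + 3 * t\<^sup>2 + t ^ 3"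
    by (simp add: power2_eq_square power3_eq_cube algebra_simps)
  have pow: "0 \<le> t\<^sup>2" "0 \<le> t ^ 3" using t by auto
  have "\<bar>(indicator {0<..} (a + \<epsilon> * w) * (a + \<epsilon> * w) ^ 3 / a ^ 3 - 1) / \<epsilon>\<bar> \<le> (1 + t) ^ 3"
  proof (cases "0 < a + \<epsilon> * w")
    case True
    define y where "y = w / a"
    have y: "\<bar>y\<bar> = t" using a by (simp add: t_def y_def)
    have "(a + \<epsilon> * w) ^ 3 / a ^ 3 = (1 + \<epsilon> * y) ^ 3"
      using a by (simp add: y_def power_divide[symmetric] add_divide_distrib)
    then have "(indicator {0<..} (a + \<epsilon> * w) * (a + \<epsilon> * w) ^ 3 / a ^ 3 - 1) / \<epsilon> =
        3 * y + 3 * (\<epsilon> * y\<^sup>2) + \<epsilon>\<^sup>2 * y ^ 3"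
      using True \<epsilon> by (simp add: power2_eq_square power3_eq_cube field_simps)
    moreover have "\<bar>\<epsilon> * y\<^sup>2\<bar> \<le> t\<^sup>2"
      using \<epsilon> y[symmetric] by (simp add: abs_mult mult_left_le_one_le)
    moreover have "\<bar>\<epsilon>\<^sup>2 * y ^ 3\<bar> \<le> t ^ 3"
      using \<epsilon> y[symmetric] by (simp add: abs_mult power_abs mult_left_le_one_le power_le_one)
    ultimately show ?thesis using y t unfolding exp by linarith
  next
    case False
    moreover have "- (\<epsilon> * w) \<le> \<epsilon> * \<bar>w\<bar>"
      using \<epsilon> abs_ge_minus_self[of "\<epsilon> * w"] by (simp only: abs_mult abs_of_pos)
    ultimately have "a \<le> \<epsilon> * \<bar>w\<bar>" by linarith
    then have "1 / \<epsilon> \<le> t" using a \<epsilon> by (simp add: t_def field_simps)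
    then have "1 / \<epsilon> \<le> (1 + t) ^ 3" using t pow unfolding exp by linarith
    then show ?thesis using False \<epsilon> by simp
  qed
  then show ?thesis by (simp add: t_def)
qed

text \<open>In the variable \<open>w\<close>, subtracting the divergent term leaves
  \<open>(\<eta> w)\<^sup>2\<close> times a difference quotient in \<open>\<epsilon>\<close> of the
  cut-off cube. Its limit is the derivative \<open>3 * w / a\<close> at 0.\<close>

lemma tendsto_Upsilon'_Upsilon':
  assumes a: "0 < a"
  shows "((\<lambda>\<epsilon>. (LBINT r. indicator {0<..} r * (r ^ 3 * (Upsilon' \<eta> a \<epsilon> 1 r * Upsilon' \<eta> a \<epsilon> 2 r)))
      - (LBINT z. (\<eta> z)\<^sup>2) / \<epsilon>) \<longlongrightarrow> 0) (at_right 0)"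
proof -
  obtain C where C: "\<And>z. \<bar>\<eta> z\<bar> \<le> C" using eta_bounded by blast
  have C0: "0 \<le> C" using C[of 0] by simp
  have sq: "(\<eta> z)\<^sup>2 \<le> \<bar>\<eta> z\<bar> * C" for z
    using mult_left_mono[OF C[of z], of "\<bar>\<eta> z\<bar>"] by (simp add: power2_eq_square)
  have int_sq: "integrable lborel (\<lambda>z. (\<eta> z)\<^sup>2)"
    by (rule Bochner_Integration.integrable_bound[of _ "\<lambda>z. \<bar>\<eta> z\<bar> * C"])
      (use sq C0 integrable_abs_eta in \<open>auto simp: abs_mult intro!: AE_I2\<close>)
  define h where "h \<epsilon> w = indicator {0<..} (a + \<epsilon> * w) * (a + \<epsilon> * w) ^ 3" for \<epsilon> w :: real
  have [measurable]: "h \<epsilon> \<in> borel_measurable borel" for \<epsilon>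
    unfolding h_def by measurable
  \<comment> \<open>Integrability of this part and of the squared mollifier allows the integral of
    their difference to be split at the end.\<close>
  have int_h: "integrable lborel (\<lambda>w. h \<epsilon> w * (\<eta> w)\<^sup>2)" if "0 < \<epsilon>" "\<epsilon> < 1" for \<epsilon>
  proof (rule Bochner_Integration.integrable_bound)
    show "integrable lborel (\<lambda>w. (a + 1 * \<bar>w\<bar>) ^ 3 * \<bar>\<eta> w\<bar> * C)"
      using integrable_affine_power[of a 1 3] a by (intro integrable_mult_left) auto
    have "\<bar>h \<epsilon> w\<bar> * (\<eta> w)\<^sup>2 \<le> (a + 1 * \<bar>w\<bar>) ^ 3 * (\<bar>\<eta> w\<bar> * C)" for w
      unfolding h_def using a by (intro mult_mono abs_affine_power_le that sq) auto
    then show "AE w in lborel. norm (h \<epsilon> w * (\<eta> w)\<^sup>2) \<le> norm ((a + 1 * \<bar>w\<bar>) ^ 3 * \<bar>\<eta> w\<bar> * C)"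
      using a C0 by (intro AE_I2) (auto simp: abs_mult mult.assoc)
  qed measurable
  have "((\<lambda>\<epsilon>. LBINT w. (h \<epsilon> w / a ^ 3 - 1) / \<epsilon> * (\<eta> w)\<^sup>2) \<longlongrightarrow>
      (LBINT w. 3 * w / a * (\<eta> w)\<^sup>2)) (at_right 0)"
  proof (rule dominated_convergence_at_right_0)
    show "integrable lborel (\<lambda>w. (1 + 1 / a * \<bar>w\<bar>) ^ 3 * \<bar>\<eta> w\<bar> * C)"
      using integrable_affine_power[of 1 "1 / a" 3] a by (intro integrable_mult_left) auto
    show "norm ((h \<epsilon> w / a ^ 3 - 1) / \<epsilon> * (\<eta> w)\<^sup>2) \<le> (1 + 1 / a * \<bar>w\<bar>) ^ 3 * \<bar>\<eta> w\<bar> * C"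
      if "0 < \<epsilon>" "\<epsilon> < 1" for \<epsilon> w
    proof -
      have "\<bar>(h \<epsilon> w / a ^ 3 - 1) / \<epsilon>\<bar> * (\<eta> w)\<^sup>2 \<le> (1 + 1 / a * \<bar>w\<bar>) ^ 3 * (\<bar>\<eta> w\<bar> * C)"
        unfolding h_def using a by (intro mult_mono abs_cubic_difference_quotient_le that sq) auto
      then show ?thesis by (simp add: abs_mult mult.assoc)
    qed
    have "((\<lambda>\<epsilon>. (h \<epsilon> w / a ^ 3 - 1) / \<epsilon> * (\<eta> w)\<^sup>2) \<longlongrightarrow> 3 * w / a * (\<eta> w)\<^sup>2) (at_right 0)" for w
    proof (rule Lim_transform_eventually)
      show "((\<lambda>\<epsilon>. (3 * w / a + 3 * \<epsilon> * (w / a)\<^sup>2 + \<epsilon>\<^sup>2 * (w / a) ^ 3) * (\<eta> w)\<^sup>2) \<longlongrightarrow>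
          3 * w / a * (\<eta> w)\<^sup>2) (at_right 0)"
        using a by (auto intro!: tendsto_eq_intros)
      show "\<forall>\<^sub>F \<epsilon> in at_right 0. (3 * w / a + 3 * \<epsilon> * (w / a)\<^sup>2 + \<epsilon>\<^sup>2 * (w / a) ^ 3) * (\<eta> w)\<^sup>2 =
          (h \<epsilon> w / a ^ 3 - 1) / \<epsilon> * (\<eta> w)\<^sup>2"
        using eventually_shift_pos[OF a, of w] eventually_at_right_less[of 0]
      proof eventually_elim
        case (elim \<epsilon>)
        then have "3 * w / a + 3 * \<epsilon> * (w / a)\<^sup>2 + \<epsilon>\<^sup>2 * (w / a) ^ 3 = (h \<epsilon> w / a ^ 3 - 1) / \<epsilon>"
          using a by (simp add: h_def power2_eq_square power3_eq_cube field_simps)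
        then show ?case by simp
      qed
    qed
    then show "AE w in lborel. ((\<lambda>\<epsilon>. (h \<epsilon> w / a ^ 3 - 1) / \<epsilon> * (\<eta> w)\<^sup>2) \<longlongrightarrow> 3 * w / a * (\<eta> w)\<^sup>2) (at_right 0)"
      by simp
  qed measurable
  also have "(LBINT w. 3 * w / a * (\<eta> w)\<^sup>2) = 0"
    \<comment> \<open>The integrand is odd, so reflection changes the sign of its integral.\<close>
    using integral_real_reflect[of "\<lambda>w. 3 * w / a * (\<eta> w)\<^sup>2"] by simp
  finally show ?thesis
  proof (rule Lim_transform_eventually)
    have "\<forall>\<^sub>F \<epsilon> in at_right (0::real). \<epsilon> < 1"
      by (rule eventually_at_right_real[THEN eventually_mono, of 0 1]) auto
    then show "\<forall>\<^sub>F \<epsilon> in at_right 0. (LBINT w. (h \<epsilon> w / a ^ 3 - 1) / \<epsilon> * (\<eta> w)\<^sup>2) =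
        (LBINT r. indicator {0<..} r * (r ^ 3 * (Upsilon' \<eta> a \<epsilon> 1 r * Upsilon' \<eta> a \<epsilon> 2 r)))
          - (LBINT z. (\<eta> z)\<^sup>2) / \<epsilon>"
      using eventually_at_right_less[of 0]
    proof eventually_elim
      case (elim \<epsilon>)
      have "(a - (a + \<epsilon> * w)) / \<epsilon> = - w" for w
        using elim by (simp add: field_simps)
      then have U: "Upsilon' \<eta> a \<epsilon> 2 (a + \<epsilon> * w) = 1 / (a\<^sup>2 * \<epsilon>) * \<eta> w" for w
        by (simp add: Upsilon'_def)
      have "(LBINT r. indicator {0<..} r * (r ^ 3 * (Upsilon' \<eta> a \<epsilon> 1 r * Upsilon' \<eta> a \<epsilon> 2 r))) =
          1 / a ^ 1 * (LBINT w. h \<epsilon> w * (\<eta> w * (1 / (a\<^sup>2 * \<epsilon>) * \<eta> w)))"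
        using elim by (simp only: integral_Upsilon'_subst h_def U)
      also have "\<dots> = (LBINT w. 1 / a ^ 1 * (h \<epsilon> w * (\<eta> w * (1 / (a\<^sup>2 * \<epsilon>) * \<eta> w))))"
        by (rule integral_mult_right_zero[symmetric])
      also have "\<dots> = (LBINT w. 1 / (a ^ 3 * \<epsilon>) * (h \<epsilon> w * (\<eta> w)\<^sup>2))"
        by (intro Bochner_Integration.integral_cong) (auto simp: power2_eq_square power3_eq_cube)
      finally have A: "(LBINT r. indicator {0<..} r * (r ^ 3 * (Upsilon' \<eta> a \<epsilon> 1 r * Upsilon' \<eta> a \<epsilon> 2 r))) =
          (LBINT w. 1 / (a ^ 3 * \<epsilon>) * (h \<epsilon> w * (\<eta> w)\<^sup>2))" .
      have "(LBINT w. (h \<epsilon> w / a ^ 3 - 1) / \<epsilon> * (\<eta> w)\<^sup>2) =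
          (LBINT w. 1 / (a ^ 3 * \<epsilon>) * (h \<epsilon> w * (\<eta> w)\<^sup>2) - (\<eta> w)\<^sup>2 / \<epsilon>)"
        using elim a by (intro Bochner_Integration.integral_cong) (auto simp: field_simps)
      also have "\<dots> = (LBINT w. 1 / (a ^ 3 * \<epsilon>) * (h \<epsilon> w * (\<eta> w)\<^sup>2)) - (LBINT w. (\<eta> w)\<^sup>2 / \<epsilon>)"
        using int_h[of \<epsilon>] int_sq elim by (intro Bochner_Integration.integral_diff) auto
      finally show ?case unfolding A by simp
    qed
  qed
qed

subsection \<open>Momentum and spin\<close>

text \<open>The function \<open>G\<close> of the introductory comment. The volume element weights it
  by \<open>r\<^sup>2\<close> for the momentum; the lever arm raises this to \<open>r ^ 3\<close>
  for the spin.\<close>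

definition radial_density :: "real \<Rightarrow> real \<Rightarrow> real \<Rightarrow> real" where
  "radial_density a \<epsilon> r = (Upsilon \<eta> a \<epsilon> 2 r - Upsilon' \<eta> a \<epsilon> 1 r) *
    (Upsilon' \<eta> a \<epsilon> 2 r - Upsilon \<eta> a \<epsilon> 3 r)"

lemma measurable_radial_density [measurable]: "radial_density a \<epsilon> \<in> borel_measurable borel"
  unfolding radial_density_def[abs_def] by measurable

context
  fixes a \<epsilon> :: real
  assumes a: "0 < a" and \<epsilon>: "0 < \<epsilon>" "\<epsilon> < 1"
begin

lemma Upsilon_decay_fixed: "\<exists>K. \<forall>r\<ge>0. \<bar>Upsilon \<eta> a \<epsilon> n r\<bar> * (1 + r ^ n) \<le> K"
  using Upsilon_decay[OF a, of n] \<epsilon> by blast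

lemma integrable_radial_density:
  assumes "k \<in> {2, 3}"
  shows "integrable lborel (\<lambda>r. indicator {0<..} r * (r ^ k * radial_density a \<epsilon> r))"
  unfolding radial_density_def
  by (intro integrable_radial_product decay_diff Upsilon_decay_fixed Upsilon'_decay a \<epsilon> assms)
    measurable

lemma integral_radial_density:
  "(LBINT r. indicator {0<..} r * (r ^ 3 * radial_density a \<epsilon> r)) =
    (LBINT r. indicator {0<..} r * (r ^ 3 * (Upsilon' \<eta> a \<epsilon> 2 r * Upsilon \<eta> a \<epsilon> 2 r)))
    + (LBINT r. indicator {0<..} r * (r ^ 3 * (Upsilon' \<eta> a \<epsilon> 1 r * Upsilon \<eta> a \<epsilon> 3 r)))
    - (LBINT r. indicator {0<..} r * (r ^ 3 * (Upsilon \<eta> a \<epsilon> 2 r * Upsilon \<eta> a \<epsilon> 3 r)))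
    - (LBINT r. indicator {0<..} r * (r ^ 3 * (Upsilon' \<eta> a \<epsilon> 1 r * Upsilon' \<eta> a \<epsilon> 2 r)))"
  (is "?J = integral\<^sup>L _ ?B1 + integral\<^sup>L _ ?B2 - integral\<^sup>L _ ?C - integral\<^sup>L _ ?A")
proof -
  \<comment> \<open>The factors are exchanged because \<open>integrable_radial_product\<close> asks
    for cubic decay of the second one: \<open>Upsilon'\<close> has it, whereas
    \<open>Upsilon\<close> of order 2 is only known to decay quadratically.\<close>
  have "integrable lborel (\<lambda>r. indicator {0<..} r * (r ^ 3 * (Upsilon \<eta> a \<epsilon> 2 r * Upsilon' \<eta> a \<epsilon> 2 r)))"
    by (intro integrable_radial_product Upsilon_decay_fixed Upsilon'_decay a \<epsilon>) auto
  then have B1: "integrable lborel ?B1" by (simp add: mult.commute)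
  have B2: "integrable lborel ?B2"
    by (intro integrable_radial_product Upsilon_decay_fixed Upsilon'_decay a \<epsilon>) auto
  have C: "integrable lborel ?C"
    by (intro integrable_radial_product Upsilon_decay_fixed Upsilon'_decay a \<epsilon>) auto
  have A: "integrable lborel ?A"
    by (intro integrable_radial_product Upsilon_decay_fixed Upsilon'_decay a \<epsilon>) auto
  have "?J = (LBINT r. ?B1 r + ?B2 r - ?C r - ?A r)"
    by (intro Bochner_Integration.integral_cong) (auto simp: radial_density_def algebra_simps)
  also have "\<dots> = integral\<^sup>L lborel ?B1 + integral\<^sup>L lborel ?B2 - integral\<^sup>L lborel ?C - integral\<^sup>L lborel ?A"
    using A B1 B2 C by simp
  finally show ?thesis .
qed

lemma integrable_momentum_density: "integrable lborel (momentum_density \<eta> e \<mu> a \<epsilon>)"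
proof -
  have "integrable lborel (\<lambda>r. (4 * pi * e) * (indicator {0<..} r * (r\<^sup>2 * radial_density a \<epsilon> r)))"
    by (intro integrable_mult_right integrable_radial_density) simp
  then have F: "integrable lborel (\<lambda>x::real^3. e * radial_density a \<epsilon> (norm x))"
    by (subst integrable_norm_3_iff[of "\<lambda>r. e * radial_density a \<epsilon> r"]) (auto simp: mult_ac)
  have "bounded_linear (\<lambda>u. cross3 u \<mu>)"
    unfolding linear_conv_bounded_linear[symmetric]
    by (simp add: linear_iff cross_add_left cross_mult_left)
  then have cont: "continuous_on UNIV (\<lambda>u. cross3 u \<mu>)"
    by (rule linear_continuous_on)
  have meas: "(\<lambda>x. cross3 (unit_vec x) \<mu>) \<in> borel_measurable borel"
    by (rule measurable_compose[OF measurable_unit_vec borel_measurable_continuous_onI[OF cont]])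
  have le: "norm (cross3 (unit_vec x) \<mu>) \<le> norm \<mu>" for x
    by (rule order_trans[OF norm_cross_le]) (simp add: norm_unit_vec)
  have "integrable lborel (\<lambda>x. (e * radial_density a \<epsilon> (norm x)) *\<^sub>R cross3 (unit_vec x) \<mu>)"
    by (rule integrable_radial_scaleR[OF F meas le])
  moreover have "momentum_density \<eta> e \<mu> a \<epsilon> =
      (\<lambda>x. (e * radial_density a \<epsilon> (norm x)) *\<^sub>R cross3 (unit_vec x) \<mu>)"
    by (simp add: fun_eq_iff momentum_density_eq radial_density_def)
  ultimately show ?thesis by simp
qed

lemma self_momentum_eq_0: "self_momentum \<eta> c e \<mu> a \<epsilon> = 0"
proof -
  \<comment> \<open>The value 0 at the origin makes \<open>unit_vec\<close> odd everywhere.\<close>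
  have "unit_vec (- x) = - unit_vec x" for x
    by (simp add: unit_vec_def)
  then have "momentum_density \<eta> e \<mu> a \<epsilon> (- x) = - momentum_density \<eta> e \<mu> a \<epsilon> x" for x
    by (simp add: momentum_density_eq)
  then have "(LBINT x. momentum_density \<eta> e \<mu> a \<epsilon> x) = 0"
    using borel_measurable_integrable[OF integrable_momentum_density]
    by (intro integral_odd_eq_0) auto
  then show ?thesis by (simp add: self_momentum_def)
qed

lemma
  shows integrable_spin_density: "integrable lborel (spin_density \<eta> e \<mu> a \<epsilon>)"
    and integral_spin_density: "(LBINT x. spin_density \<eta> e \<mu> a \<epsilon> x) =
      - (8 * pi * e / 3 * (LBINT r. indicator {0<..} r * (r ^ 3 * radial_density a \<epsilon> r))) *\<^sub>R \<mu>"
proof -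
  \<comment> \<open>The factor \<open>r\<close> of the lever arm also secures
    \<open>?F 0 = 0\<close>, as the second-moment formula requires.\<close>
  let ?F = "\<lambda>r. e * r * radial_density a \<epsilon> r"
  have eq: "(\<lambda>r. indicator {0<..} r * (4 * pi * r\<^sup>2) * ?F r) =
      (\<lambda>r. (4 * pi * e) * (indicator {0<..} r * (r ^ 3 * radial_density a \<epsilon> r)))"
    by (simp add: fun_eq_iff power2_eq_square power3_eq_cube)
  have "integrable lborel (\<lambda>r. (4 * pi * e) * (indicator {0<..} r * (r ^ 3 * radial_density a \<epsilon> r)))"
    by (intro integrable_mult_right integrable_radial_density) simp
  then have F: "integrable lborel (\<lambda>x::real^3. ?F (norm x))"
    by (subst integrable_norm_3_iff[of ?F]) (auto simp only: eq, measurable)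
  have I: "(LBINT x::real^3. ?F (norm x)) =
      4 * pi * e * (LBINT r. indicator {0<..} r * (r ^ 3 * radial_density a \<epsilon> r))"
    by (subst integral_norm_3[of ?F]) (measurable, simp only: eq integral_mult_right_zero)
  have spin: "spin_density \<eta> e \<mu> a \<epsilon> = (\<lambda>x. ?F (norm x) *\<^sub>R ((\<mu> \<bullet> unit_vec x) *\<^sub>R unit_vec x - \<mu>))"
    by (simp add: fun_eq_iff spin_density_eq radial_density_def)
  show "integrable lborel (spin_density \<eta> e \<mu> a \<epsilon>)"
    unfolding spin by (rule radial_spin_integral[OF F]) simp
  show "(LBINT x. spin_density \<eta> e \<mu> a \<epsilon> x) =
      - (8 * pi * e / 3 * (LBINT r. indicator {0<..} r * (r ^ 3 * radial_density a \<epsilon> r))) *\<^sub>R \<mu>"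
    unfolding spin by (subst radial_spin_integral(2)[OF F], simp, subst I) simp
qed

end

lemma tendsto_integral_radial_density:
  assumes a: "0 < a"
  shows "((\<lambda>\<epsilon>. (LBINT r. indicator {0<..} r * (r ^ 3 * radial_density a \<epsilon> r))
    + (LBINT z. (\<eta> z)\<^sup>2) / \<epsilon>) \<longlongrightarrow> 0) (at_right 0)"
proof -
  let ?J = "\<lambda>f. LBINT r. indicator {0<..} r * (r ^ 3 * f r) :: real"
  have "((\<lambda>\<epsilon>. ?J (\<lambda>r. Upsilon' \<eta> a \<epsilon> 2 r * Upsilon \<eta> a \<epsilon> 2 r)
      + ?J (\<lambda>r. Upsilon' \<eta> a \<epsilon> 1 r * Upsilon \<eta> a \<epsilon> 3 r)
      - ?J (\<lambda>r. Upsilon \<eta> a \<epsilon> 2 r * Upsilon \<eta> a \<epsilon> 3 r)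
      - (?J (\<lambda>r. Upsilon' \<eta> a \<epsilon> 1 r * Upsilon' \<eta> a \<epsilon> 2 r) - (LBINT z. (\<eta> z)\<^sup>2) / \<epsilon>)) \<longlongrightarrow>
      a ^ 3 / (2 * a ^ (2 + 2)) + a ^ 3 / (2 * a ^ (1 + 3)) - 1 / a - 0) (at_right 0)"
    by (intro tendsto_intros tendsto_Upsilon'_Upsilon tendsto_Upsilon_Upsilon tendsto_Upsilon'_Upsilon' a)
  also have "a ^ 3 / (2 * a ^ (2 + 2)) + a ^ 3 / (2 * a ^ (1 + 3)) - 1 / a - 0 = 0"
    using a by (simp add: field_simps power3_eq_cube power4_eq_xxxx)
  finally show ?thesis
  proof (rule Lim_transform_eventually)
    have "\<forall>\<^sub>F \<epsilon> in at_right 0. \<epsilon> \<in> {0<..<1::real}"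
      by (rule eventually_at_right_real) simp
    then show "\<forall>\<^sub>F \<epsilon> in at_right 0. ?J (\<lambda>r. Upsilon' \<eta> a \<epsilon> 2 r * Upsilon \<eta> a \<epsilon> 2 r)
      + ?J (\<lambda>r. Upsilon' \<eta> a \<epsilon> 1 r * Upsilon \<eta> a \<epsilon> 3 r)
      - ?J (\<lambda>r. Upsilon \<eta> a \<epsilon> 2 r * Upsilon \<eta> a \<epsilon> 3 r)
      - (?J (\<lambda>r. Upsilon' \<eta> a \<epsilon> 1 r * Upsilon' \<eta> a \<epsilon> 2 r) - (LBINT z. (\<eta> z)\<^sup>2) / \<epsilon>) =
      ?J (radial_density a \<epsilon>) + (LBINT z. (\<eta> z)\<^sup>2) / \<epsilon>"
    proof eventually_elim
      case (elim \<epsilon>)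
      then have "0 < \<epsilon>" "\<epsilon> < 1" by auto
      then show ?case
        unfolding integral_radial_density[OF a \<open>0 < \<epsilon>\<close> \<open>\<epsilon> < 1\<close>] by linarith
    qed
  qed
qed

lemma tendsto_self_spin:
  assumes a: "0 < a" and c: "0 < c"
  shows "((\<lambda>\<epsilon>. self_spin \<eta> c e \<mu> a \<epsilon> - (2 * e / (3 * c) * ((LBINT z. (\<eta> (- z))\<^sup>2) / \<epsilon>)) *\<^sub>R \<mu>)
    \<longlongrightarrow> 0) (at_right 0)"
proof -
  let ?J = "\<lambda>\<epsilon>. LBINT r. indicator {0<..} r * (r ^ 3 * radial_density a \<epsilon> r)"
  have "((\<lambda>\<epsilon>. (- (2 * e / (3 * c)) * (?J \<epsilon> + (LBINT z. (\<eta> z)\<^sup>2) / \<epsilon>)) *\<^sub>R \<mu>)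
      \<longlongrightarrow> (- (2 * e / (3 * c)) * 0) *\<^sub>R \<mu>) (at_right 0)"
    by (intro tendsto_intros tendsto_integral_radial_density a)
  then have "((\<lambda>\<epsilon>. (- (2 * e / (3 * c)) * (?J \<epsilon> + (LBINT z. (\<eta> z)\<^sup>2) / \<epsilon>)) *\<^sub>R \<mu>)
      \<longlongrightarrow> 0) (at_right 0)" by simp
  then show ?thesis
  proof (rule Lim_transform_eventually)
    have "\<forall>\<^sub>F \<epsilon> in at_right 0. \<epsilon> \<in> {0<..<1::real}"
      by (rule eventually_at_right_real) simp
    then show "\<forall>\<^sub>F \<epsilon> in at_right 0. (- (2 * e / (3 * c)) * (?J \<epsilon> + (LBINT z. (\<eta> z)\<^sup>2) / \<epsilon>)) *\<^sub>R \<mu> =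
        self_spin \<eta> c e \<mu> a \<epsilon> - (2 * e / (3 * c) * ((LBINT z. (\<eta> (- z))\<^sup>2) / \<epsilon>)) *\<^sub>R \<mu>"
    proof eventually_elim
      case (elim \<epsilon>)
      then have "0 < \<epsilon>" "\<epsilon> < 1" by auto
      then have "self_spin \<eta> c e \<mu> a \<epsilon> = (1 / (4 * pi * c) * - (8 * pi * e / 3 * ?J \<epsilon>)) *\<^sub>R \<mu>"
        unfolding self_spin_def integral_spin_density[OF a \<open>0 < \<epsilon>\<close> \<open>\<epsilon> < 1\<close>] by simp
      also have "1 / (4 * pi * c) * - (8 * pi * e / 3 * ?J \<epsilon>) = - (2 * e / (3 * c)) * ?J \<epsilon>"
        using c by (simp add: field_simps)
      \<comment> \<open>Evenness identifies the integral of \<open>(\<eta> (- z))\<^sup>2\<close>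
        with that of \<open>(\<eta> z)\<^sup>2\<close>.\<close>
      finally show ?case
        by (simp only: even scaleR_left_diff_distrib[symmetric]) (simp add: algebra_simps)
    qed
  qed
qed

end

theorem mainTheorem4:
  fixes \<eta> :: "real \<Rightarrow> real" and e c :: real and \<mu> :: "real ^ 3"
  assumes "mollifier \<eta>" and "c > 0"
  shows
    "(\<forall>a\<in>{0<..<1}. \<forall>\<epsilon>\<in>{0<..<1}.
        integrable lborel (momentum_density \<eta> e \<mu> a \<epsilon>) \<and>
        integrable lborel (spin_density \<eta> e \<mu> a \<epsilon>)) \<and>
     (\<forall>a\<in>{0<..<1}. \<forall>\<epsilon>\<in>{0<..<1}. self_momentum \<eta> c e \<mu> a \<epsilon> = 0) \<and>
     (\<forall>a\<in>{0<..<1}.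
        ((\<lambda>\<epsilon>. self_spin \<eta> c e \<mu> a \<epsilon>
               - (2 * e / (3 * c) * ((LBINT z. (\<eta> (- z))\<^sup>2) / \<epsilon>)) *\<^sub>R \<mu>)
          \<longlongrightarrow> 0) (at_right 0))"
proof -
  interpret mollifier_function \<eta>
    by unfold_locales (rule assms)
  show ?thesis
    using integrable_momentum_density integrable_spin_density self_momentum_eq_0
      tendsto_self_spin[OF _ assms(2)]
    by simp
qed

end
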